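(* Let $d\ge 2$ be an integer. The critical heights map $\mathcal{G}:\mathcal{M}_d\to\mathcal{H}_d$ is continuous, proper and surjective.
   Context: $\mathcal{M}_d$ is the space of conformal (i.e. affine) conjugacy classes of complex polynomials $f:\mathbb{C}\to\mathbb{C}$ of degree $d$, topologized as the quotient of the space $\mathcal{P}_d\simeq\mathbb{C}^{d-1}$ of monic centered polynomials $z^d+a_2z^{d-2}+\cdots+a_d$ by conjugation by $z\mapsto\zeta z$ with $\zeta^{d-1}=1$. The escape-rate function of $f$ is $G_f(z)=\lim_{n\to\infty}d^{-n}\log^+|f^n(z)|$. The critical points of $f$ in $\mathbb{C}$, counted with multiplicity, are labelled $c_1,\dots,c_{d-1}$ so that $G_f(c_1)\ge G_f(c_2)\ge\cdots\ge G_f(c_{d-1})$. The critical heights map is $\mathcal{G}(f)=(G_f(c_1),\dots,G_f(c_{d-1}))$, which depends only on the conjugacy class of $f$. Its codomain is $\mathcal{H}_d=\{(h_1,\dots,h_{d-1})\in\mathbb{R}^{d-1}: h_1\ge h_2\ge\cdots\ge h_{d-1}\ge 0\}$. *)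

theory Defs
  imports "HOL-Analysis.Analysis" "HOL-Computational_Algebra.Fundamental_Theorem_Algebra"
begin

section \<open>Moduli space of polynomials\<close>

definition affine_conj :: "complex poly \<Rightarrow> complex poly \<Rightarrow> bool" where
  "affine_conj f g \<longleftrightarrow>
     (\<exists>a b. a \<noteq> 0 \<and> pcompose g [:b, a:] = pcompose [:b, a:] f)"

definition affine_conj_rel :: "nat \<Rightarrow> (complex poly \<times> complex poly) set" where
  "affine_conj_rel d = {(f, g). degree f = d \<and> degree g = d \<and> affine_conj f g}"

definition conj_class :: "complex poly \<Rightarrow> complex poly set" where
  "conj_class f = affine_conj_rel (degree f) `` {f}"

definition moduli_set :: "nat \<Rightarrow> complex poly set set" where
  "moduli_set d = {f. degree f = d} // affine_conj_rel d"

definition monic_centered :: "nat \<Rightarrow> complex poly set" where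
  "monic_centered d = {f. degree f = d \<and> lead_coeff f = 1 \<and> coeff f (d - 1) = 0}"

text \<open>
  The identification of \<^term>\<open>monic_centered d\<close> with the \<open>(d - 1)\<close>-fold power of the complex plane
  given by the coefficients of degree \<open>0, \<dots>, d - 2\<close>.
\<close>

definition monic_centered_topology :: "nat \<Rightarrow> complex poly topology" where
  "monic_centered_topology d =
     pullback_topology (monic_centered d) (\<lambda>f. \<lambda>i\<in>{..<d - 1}. coeff f i)
       (product_topology (\<lambda>_. euclidean) {..<d - 1})"

text \<open>
  The quotient topology; see \<open>quotient_map_conj_class\<close> and \<open>affine_conj_monic_centered_iff\<close> below.
\<close>

definition moduli_space :: "nat \<Rightarrow> complex poly set topology" where
  "moduli_space d = topology (\<lambda>U. U \<subseteq> moduli_set d \<and>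
     openin (monic_centered_topology d) {f \<in> monic_centered d. conj_class f \<in> U})"


section \<open>Critical heights\<close>

definition escape_rate :: "complex poly \<Rightarrow> complex \<Rightarrow> real" where
  "escape_rate f z =
     lim (\<lambda>n. max 0 (ln (cmod ((poly f ^^ n) z))) / real (degree f) ^ n)"

text \<open>
  At a point \<open>0\<close> of an orbit the numerator is \<open>0\<close>, as it should be, since \<^prop>\<open>ln 0 = (0 :: real)\<close>.
  The multiset \<^term>\<open>proots (pderiv f)\<close> consists of the critical points with multiplicity.
\<close>

definition critical_heights :: "complex poly \<Rightarrow> nat \<Rightarrow> real" where
  "critical_heights f =
     (\<lambda>i\<in>{1..degree f - 1}.
        rev (sorted_list_of_multiset (image_mset (escape_rate f) (proots (pderiv f)))) ! (i - 1))"

definition heights_space :: "nat \<Rightarrow> (nat \<Rightarrow> real) topology" where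
  "heights_space d = subtopology (powertop_real {1..d - 1})
     {h. (\<forall>i\<in>{1..d - 1}. 0 \<le> h i) \<and> (\<forall>i\<in>{1..d - 1}. \<forall>j\<in>{1..d - 1}. i \<le> j \<longrightarrow> h j \<le> h i)}"

text \<open>
  The common value of \<^term>\<open>critical_heights\<close> on a conjugacy class;
  see \<open>critical_heights_map_conj_class\<close> below.
\<close>

definition critical_heights_map :: "complex poly set \<Rightarrow> nat \<Rightarrow> real" where
  "critical_heights_map C = the_elem (critical_heights ` C)"


section \<open>Consistency of the definitions\<close>

lemma critical_heights_labelling:
  assumes "mset cs = proots (pderiv f)"
    and "sorted_wrt (\<lambda>z w. escape_rate f z \<ge> escape_rate f w) cs"
    and "i \<in> {1..degree f - 1}"
  shows "critical_heights f i = escape_rate f (cs ! (i - 1))"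
proof -
  let ?xs = "map (escape_rate f) cs"
  have "sorted (rev ?xs)"
    using assms(2) by (simp add: sorted_wrt_rev sorted_wrt_map)
  moreover have "mset (rev ?xs) = image_mset (escape_rate f) (proots (pderiv f))"
    using assms(1) by simp
  ultimately have "sorted_list_of_multiset (image_mset (escape_rate f) (proots (pderiv f))) = rev ?xs"
    by (metis sorted_list_of_multiset_mset sorted_sort_id)
  moreover have "i - 1 < length cs"
  proof -
    have "length cs = degree (pderiv f)"
      using assms(1) size_proots_complex by (metis size_mset)
    then show ?thesis using assms(3) by (auto simp: degree_pderiv)
  qed
  ultimately show ?thesis using assms(3) by (simp add: critical_heights_def)
qed

lemma affine_conj_refl: "affine_conj f f"
  unfolding affine_conj_def
  by (rule exI[of _ 1], rule exI[of _ 0]) (simp add: pcompose_idR pcompose_pCons)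

lemma affine_conj_iff_poly:
  "affine_conj f g \<longleftrightarrow> (\<exists>a b. a \<noteq> 0 \<and> (\<forall>z. poly g (a * z + b) = a * poly f z + b))"
  unfolding affine_conj_def
  by (simp add: poly_eq_poly_eq_iff[symmetric] fun_eq_iff poly_pcompose algebra_simps)

lemma affine_conj_sym:
  assumes "affine_conj f g" shows "affine_conj g f"
proof -
  obtain a b where ab: "a \<noteq> 0" "\<And>z. poly g (a * z + b) = a * poly f z + b"
    using assms unfolding affine_conj_iff_poly by blast
  have "poly f (1 / a * z + (- b / a)) = 1 / a * poly g z + (- b / a)" for z
    using ab(1) ab(2)[of "1 / a * z + (- b / a)"] by (simp add: field_simps)
  then show ?thesis using ab(1) unfolding affine_conj_iff_poly
    by (intro exI[of _ "1 / a"] exI[of _ "- b / a"]) auto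
qed

lemma affine_conj_trans:
  assumes "affine_conj f g" "affine_conj g h" shows "affine_conj f h"
proof -
  obtain a b where ab: "a \<noteq> 0" "\<And>z. poly g (a * z + b) = a * poly f z + b"
    using assms unfolding affine_conj_iff_poly by blast
  obtain a' b' where ab': "a' \<noteq> 0" "\<And>z. poly h (a' * z + b') = a' * poly g z + b'"
    using assms unfolding affine_conj_iff_poly by blast
  have "poly h ((a' * a) * z + (a' * b + b')) = (a' * a) * poly f z + (a' * b + b')" for z
    using ab'(2)[of "a * z + b"] ab(2)[of z] by (simp add: algebra_simps)
  moreover have "a' * a \<noteq> 0" using ab ab' by simp
  ultimately show ?thesis unfolding affine_conj_iff_poly by blast
qed

lemma equiv_affine_conj_rel: "equiv {f. degree f = d} (affine_conj_rel d)"
  by (rule equivI)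
     (auto simp: affine_conj_rel_def refl_on_def sym_def trans_def
        intro: affine_conj_refl affine_conj_sym affine_conj_trans)

lemma conj_class_eq_iff:
  assumes "degree f = d" "degree g = d"
  shows "conj_class f = conj_class g \<longleftrightarrow> affine_conj f g"
  using eq_equiv_class_iff[OF equiv_affine_conj_rel[of d], of f g] assms
  by (auto simp: conj_class_def affine_conj_rel_def)

lemma istopology_moduli:
  "istopology (\<lambda>U. U \<subseteq> moduli_set d \<and>
     openin (monic_centered_topology d) {f \<in> monic_centered d. conj_class f \<in> U})"
proof -
  have 1: "{f \<in> M. c f \<in> S \<inter> T} = {f \<in> M. c f \<in> S} \<inter> {f \<in> M. c f \<in> T}"
    for M S T and c :: "complex poly \<Rightarrow> complex poly set"
    by auto
  have 2: "{f \<in> M. c f \<in> \<Union>K} = (\<Union>S\<in>K. {f \<in> M. c f \<in> S})"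
    for M K and c :: "complex poly \<Rightarrow> complex poly set"
    by auto
  show ?thesis
    unfolding istopology_def 1 2 by (blast intro: openin_Int openin_Union)
qed

lemma openin_moduli_space:
  "openin (moduli_space d) U \<longleftrightarrow> U \<subseteq> moduli_set d \<and>
     openin (monic_centered_topology d) {f \<in> monic_centered d. conj_class f \<in> U}"
  unfolding moduli_space_def topology_inverse'[OF istopology_moduli] ..

lemma topspace_monic_centered: "topspace (monic_centered_topology d) = monic_centered d"
  by (auto simp: monic_centered_topology_def topspace_pullback_topology)

lemma conj_class_in_moduli_set: "degree f = d \<Longrightarrow> conj_class f \<in> moduli_set d"
  by (auto simp: moduli_set_def conj_class_def quotientI)

lemma topspace_moduli_space: "topspace (moduli_space d) = moduli_set d"
proof -
  have "{f \<in> monic_centered d. conj_class f \<in> moduli_set d} = topspace (monic_centered_topology d)"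
    by (auto simp: topspace_monic_centered monic_centered_def conj_class_in_moduli_set)
  then have "openin (moduli_space d) (moduli_set d)"
    by (simp add: openin_moduli_space)
  then show ?thesis
    by (metis openin_moduli_space openin_subset openin_topspace subset_antisym)
qed

lemma poly_altdef':
  fixes p :: "complex poly"
  assumes "degree p \<le> d" shows "poly p x = (\<Sum>i\<le>d. coeff p i * x ^ i)"
proof -
  have "(\<Sum>i\<le>degree p. coeff p i * x ^ i) = (\<Sum>i\<le>d. coeff p i * x ^ i)"
    using assms by (intro sum.mono_neutral_left) (auto simp: coeff_eq_0)
  then show ?thesis by (simp add: poly_altdef)
qed

lemma coeff_pcompose_linear:
  fixes p :: "complex poly"
  assumes "d \<ge> 1" "degree p \<le> d"
  shows "coeff (pcompose p [:b, a:]) (d - 1) = (coeff p (d - 1) + coeff p d * of_nat d * b) * a ^ (d - 1)"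
    and "coeff (pcompose p [:b, a:]) d = coeff p d * a ^ d"
proof -
  let ?q = "[:b, a:]"
  have e: "pcompose p ?q = (\<Sum>i\<le>d. smult (coeff p i) (?q ^ i))"
    by (simp add: poly_eq_poly_eq_iff[symmetric] fun_eq_iff poly_pcompose poly_sum
        poly_altdef'[OF assms(2)])
  have z: "coeff (?q ^ i) k = 0" if "i < k" for i k
    using that degree_power_le[of ?q i] by (intro coeff_eq_0) (auto split: if_splits)
  have "coeff (pcompose p ?q) (d - 1) = (\<Sum>i\<le>d. coeff p i * coeff (?q ^ i) (d - 1))"
    by (simp add: e coeff_sum)
  also have "\<dots> = (\<Sum>i\<in>{d - 1, d}. coeff p i * coeff (?q ^ i) (d - 1))"
    by (rule sum.mono_neutral_right) (auto intro!: z)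
  also have "\<dots> = coeff p (d - 1) * coeff (?q ^ (d - 1)) (d - 1) + coeff p d * coeff (?q ^ d) (d - 1)"
    using assms by auto
  also have "\<dots> = (coeff p (d - 1) + coeff p d * of_nat d * b) * a ^ (d - 1)"
    using assms binomial_symmetric[of "d - 1" d]
    by (simp add: coeff_linear_poly_power algebra_simps)
  finally show "coeff (pcompose p ?q) (d - 1) = \<dots>" .
  have "coeff (pcompose p ?q) d = (\<Sum>i\<le>d. coeff p i * coeff (?q ^ i) d)"
    by (simp add: e coeff_sum)
  also have "\<dots> = (\<Sum>i\<in>{d}. coeff p i * coeff (?q ^ i) d)"
    by (rule sum.mono_neutral_right) (auto intro!: z)
  finally show "coeff (pcompose p ?q) d = coeff p d * a ^ d"
    by (simp add: coeff_linear_poly_power)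
qed

lemma exists_monic_centered:
  assumes "d \<ge> 2" "degree f = d"
  shows "\<exists>g\<in>monic_centered d. affine_conj f g"
proof -
  define L where "L = coeff f d"
  have L: "L \<noteq> 0" using assms by (auto simp: L_def)
  obtain a where a: "a ^ (d - 1) = L"
    using nth_root_exists[of "d - 1" L] assms by auto
  have a0: "a \<noteq> 0" using a L assms by (auto simp: power_0_left)
  have ad: "a ^ d = a * L" using a assms(1) by (cases d) auto
  define b where "b = - coeff f (d - 1) / (of_nat d * L)"
  define g where "g = pcompose [:- a * b, a:] (pcompose f [:b, 1 / a:])"
  have dg: "degree g = d"
    using assms a0 by (simp add: g_def degree_pcompose)
  have gform: "g = [:- a * b:] + smult a (pcompose f [:b, 1 / a:])"
    by (simp add: g_def pcompose_pCons)
  have cg: "coeff g k = a * coeff (pcompose f [:b, 1 / a:]) k" if "k \<ge> 1" for k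
    using that by (cases k) (auto simp: gform)
  have "coeff g d = 1"
    using assms a0 L by (simp add: cg coeff_pcompose_linear power_divide ad flip: L_def)
  moreover have "coeff g (d - 1) = 0"
  proof -
    have "coeff (pcompose f [:b, 1 / a:]) (d - 1) = 0"
      using assms L coeff_pcompose_linear(1)[of d f b "1 / a"] by (simp add: b_def flip: L_def)
    then show ?thesis using assms(1) cg[of "d - 1"] by simp
  qed
  ultimately have "g \<in> monic_centered d"
    using dg by (simp add: monic_centered_def)
  moreover have "affine_conj f g"
    unfolding affine_conj_iff_poly using a0
    by (intro exI[of _ a] exI[of _ "- a * b"]) (auto simp: g_def poly_pcompose field_simps)
  ultimately show ?thesis by blast
qed

lemma quotient_map_conj_class:
  assumes "d \<ge> 2"
  shows "quotient_map (monic_centered_topology d) (moduli_space d) conj_class"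
  unfolding quotient_map_def topspace_moduli_space topspace_monic_centered
proof (intro conjI allI impI equalityI subsetI)
  fix C assume "C \<in> moduli_set d"
  then obtain f where f: "degree f = d" "C = conj_class f"
    by (auto simp: moduli_set_def quotient_def conj_class_def)
  then obtain g where g: "g \<in> monic_centered d" "affine_conj f g"
    using exists_monic_centered assms by blast
  then have "C = conj_class g"
    using f conj_class_eq_iff[of f d g] by (simp add: monic_centered_def)
  then show "C \<in> conj_class ` monic_centered d" using g by blast
qed (auto simp: openin_moduli_space monic_centered_def conj_class_in_moduli_set)

lemma affine_conj_monic_centered_iff:
  assumes "d \<ge> 2" "f \<in> monic_centered d" "g \<in> monic_centered d"
  shows "affine_conj f g \<longleftrightarrow>
    (\<exists>\<zeta>. \<zeta> ^ (d - 1) = 1 \<and> pcompose g [:0, \<zeta>:] = pcompose [:0, \<zeta>:] f)"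
proof
  assume "affine_conj f g"
  then obtain a b where ab: "a \<noteq> 0" "pcompose g [:b, a:] = pcompose [:b, a:] f"
    unfolding affine_conj_def by blast
  have f: "degree f = d" "coeff f d = 1" "coeff f (d - 1) = 0"
    and g: "degree g = d" "coeff g d = 1" "coeff g (d - 1) = 0"
    using assms by (auto simp: monic_centered_def)
  have r: "coeff (pcompose g [:b, a:]) k = a * coeff f k" if "k \<ge> 1" for k
    using that ab(2) by (cases k) (auto simp: pcompose_pCons)
  have "a ^ d = a"
    using r[of d] assms(1) f g by (simp add: coeff_pcompose_linear)
  then have 1: "a ^ (d - 1) = 1"
    using ab(1) assms(1) by (cases d) auto
  have "coeff (pcompose g [:b, a:]) (d - 1) = 0"
    using r[of "d - 1"] assms(1) f(3) by simp
  then have "of_nat d * b * a ^ (d - 1) = 0"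
    using assms(1) g coeff_pcompose_linear(1)[of d g b a] by simp
  then have "b = 0" using ab(1) assms(1) by simp
  then show "\<exists>\<zeta>. \<zeta> ^ (d - 1) = 1 \<and> pcompose g [:0, \<zeta>:] = pcompose [:0, \<zeta>:] f"
    using ab 1 by blast
next
  assume "\<exists>\<zeta>. \<zeta> ^ (d - 1) = 1 \<and> pcompose g [:0, \<zeta>:] = pcompose [:0, \<zeta>:] f"
  then obtain \<zeta> where "\<zeta> ^ (d - 1) = 1" "pcompose g [:0, \<zeta>:] = pcompose [:0, \<zeta>:] f" by blast
  moreover from this have "\<zeta> \<noteq> 0" using assms(1) by (auto simp: power_0_left)
  ultimately show "affine_conj f g" unfolding affine_conj_def by blast
qed

lemma proots_pcompose_linear:
  fixes p :: "complex poly"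
  assumes "a \<noteq> 0"
  shows "proots p = image_mset (\<lambda>z. a * z + b) (proots (pcompose p [:b, a:]))"
proof -
  have *: "proots (pcompose (\<Prod>x\<in>#A. [:- x, 1:]) [:b, a:]) = image_mset (\<lambda>z. (z - b) / a) A
      \<and> pcompose (\<Prod>x\<in>#A. [:- x, 1:]) [:b, a:] \<noteq> 0" for A
  proof (induction A)
    case (add x A)
    let ?l = "smult a [:- ((x - b) / a), 1:]"
    have mult: "proots (q * r) = add_mset y M \<and> q * r \<noteq> 0"
      if "proots q = {#y#}" "q \<noteq> 0" "proots r = M \<and> r \<noteq> 0" for q r :: "complex poly" and y M
      using that by (simp add: proots_mult)
    have "pcompose [:- x, 1:] [:b, a:] = ?l"
      using assms by (simp add: pcompose_pCons field_simps)
    then have eq: "pcompose (\<Prod>y\<in>#add_mset x A. [:- y, 1:]) [:b, a:] =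
        ?l * pcompose (\<Prod>y\<in>#A. [:- y, 1:]) [:b, a:]"
      by (simp only: image_mset_add_mset prod_mset.add_mset pcompose_mult)
    have "proots ?l = {#(x - b) / a#}"
      using assms by (metis minus_minus proots_linear_factor proots_smult)
    moreover have "?l \<noteq> 0" using assms by simp
    ultimately show ?case
      unfolding eq image_mset_add_mset[of "\<lambda>z. (z - b) / a"] using add by (rule mult)
  qed (simp add: pcompose_1)
  show ?thesis
  proof (cases "p = 0")
    case False
    have "pcompose p [:b, a:] = smult (lead_coeff p) (pcompose (\<Prod>x\<in>#proots p. [:- x, 1:]) [:b, a:])"
      by (metis complex_poly_decompose_multiset pcompose_smult)
    then have "proots (pcompose p [:b, a:]) = image_mset (\<lambda>z. (z - b) / a) (proots p)"
      using * False by simp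
    then show ?thesis using assms by (simp add: image_mset.compositionality o_def)
  qed simp
qed

lemma ln_plus_affine_bound:
  "\<exists>C. \<forall>w :: complex. max 0 (ln (cmod (a * w + b))) \<le> max 0 (ln (cmod w)) + C"
proof (intro exI allI)
  fix w :: complex
  define K where "K = 1 + cmod a + cmod b"
  have K: "K \<ge> 1" by (simp add: K_def)
  have l: "max 0 (ln x) = ln (max 1 x)" if "x \<ge> 0" for x :: real
    using that by (cases "x = 0") (auto simp: max_def)
  have "cmod (a * w + b) \<le> cmod a * cmod w + cmod b"
    by (metis norm_mult norm_triangle_ineq)
  also have "\<dots> \<le> cmod a * max 1 (cmod w) + cmod b * max 1 (cmod w)"
    by (intro add_mono mult_left_mono) (auto simp: mult_le_cancel_left1)
  also have "\<dots> \<le> K * max 1 (cmod w)" by (simp add: K_def algebra_simps)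
  finally have "max 1 (cmod (a * w + b)) \<le> K * max 1 (cmod w)"
    using K mult_mono[of 1 K 1 "max 1 (cmod w)"] by auto
  then have "ln (max 1 (cmod (a * w + b))) \<le> ln (K * max 1 (cmod w))"
    by (intro ln_mono) auto
  also have "\<dots> = ln K + ln (max 1 (cmod w))"
    using K by (intro ln_mult_pos) auto
  finally show "max 0 (ln (cmod (a * w + b))) \<le> max 0 (ln (cmod w)) + ln (1 + cmod a + cmod b)"
    by (simp add: l K_def)
qed

lemma escape_rate_conj:
  assumes "a \<noteq> 0" "degree f = d" "degree g = d" "d \<ge> 2"
    and "\<And>z. poly g (a * z + b) = a * poly f z + b"
  shows "escape_rate g (a * z + b) = escape_rate f z"
proof -
  define w where "w n = (poly f ^^ n) z" for n
  have it: "(poly g ^^ n) (a * z + b) = a * w n + b" for n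
    by (induction n) (simp_all add: w_def assms(5))
  define X where "X n = max 0 (ln (cmod (w n))) / real d ^ n" for n
  define Y where "Y n = max 0 (ln (cmod (a * w n + b))) / real d ^ n" for n
  obtain C where C: "\<And>w. max 0 (ln (cmod (a * w + b))) \<le> max 0 (ln (cmod w)) + C"
    using ln_plus_affine_bound[of a b] by blast
  obtain D where D: "\<And>w. max 0 (ln (cmod (1 / a * w + - b / a))) \<le> max 0 (ln (cmod w)) + D"
    using ln_plus_affine_bound[of "1 / a" "- b / a"] by blast
  have inv: "1 / a * (a * u + b) + - b / a = u" for u
    using assms(1) by (simp add: field_simps)
  define B where "B = max C D"
  have bd: "\<bar>Y n - X n\<bar> \<le> B * (1 / real d) ^ n" for n
  proof -
    have "\<bar>max 0 (ln (cmod (a * w n + b))) - max 0 (ln (cmod (w n)))\<bar> \<le> B"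
      using C[of "w n"] D[of "a * w n + b"] unfolding inv by (auto simp: B_def abs_le_iff)
    then have "\<bar>max 0 (ln (cmod (a * w n + b))) - max 0 (ln (cmod (w n)))\<bar> / real d ^ n
        \<le> B / real d ^ n"
      by (rule divide_right_mono) simp
    then show ?thesis
      by (simp add: X_def Y_def power_divide flip: diff_divide_distrib)
  qed
  have "(\<lambda>n. B * (1 / real d) ^ n) \<longlonglongrightarrow> 0"
    using assms(4) by (intro tendsto_mult_right_zero LIMSEQ_power_zero) auto
  then have d0: "(\<lambda>n. Y n - X n) \<longlonglongrightarrow> 0"
    by (rule Lim_null_comparison[rotated]) (use bd in auto)
  have "Y \<longlonglongrightarrow> L \<longleftrightarrow> X \<longlonglongrightarrow> L" for L
    using Lim_transform[OF _ d0, of L] Lim_transform2[OF _ d0, of L] by blast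
  then have "lim Y = lim X" by (simp add: lim_def)
  then show ?thesis
    by (simp add: escape_rate_def it assms(2,3) X_def[abs_def] Y_def[abs_def] flip: w_def)
qed

lemma critical_heights_conj:
  assumes "degree f = d" "degree g = d" "d \<ge> 2" "affine_conj f g"
  shows "critical_heights g = critical_heights f"
proof -
  obtain a b where ab: "a \<noteq> 0" "pcompose g [:b, a:] = pcompose [:b, a:] f"
    using assms unfolding affine_conj_def by blast
  have ev: "poly g (a * z + b) = a * poly f z + b" for z
    using arg_cong[OF ab(2), of "\<lambda>p. poly p z"] by (simp add: poly_pcompose algebra_simps)
  have "smult a (pcompose (pderiv g) [:b, a:]) = smult a (pderiv f)"
    using arg_cong[OF ab(2), of pderiv]
    by (simp add: pderiv_pcompose pderiv_pCons pcompose_pCons pderiv_add pderiv_smult mult.commute)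
  then have "pcompose (pderiv g) [:b, a:] = pderiv f"
    using ab(1) by (metis smult_cancel)
  then have "proots (pderiv g) = image_mset (\<lambda>z. a * z + b) (proots (pderiv f))"
    using proots_pcompose_linear[OF ab(1), of "pderiv g" b] by simp
  then have "image_mset (escape_rate g) (proots (pderiv g)) = image_mset (escape_rate f) (proots (pderiv f))"
    using escape_rate_conj[OF ab(1) assms(1-3) ev] by (simp add: image_mset.compositionality o_def)
  then show ?thesis using assms by (simp add: critical_heights_def)
qed

lemma critical_heights_map_conj_class:
  assumes "degree f \<ge> 2"
  shows "critical_heights_map (conj_class f) = critical_heights f"
proof -
  have "f \<in> conj_class f"
    by (simp add: conj_class_def affine_conj_rel_def affine_conj_refl)
  moreover have "critical_heights g = critical_heights f" if "g \<in> conj_class f" for g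
    using that assms critical_heights_conj[of f "degree f" g]
    by (simp add: conj_class_def affine_conj_rel_def)
  ultimately have "critical_heights ` conj_class f = {critical_heights f}"
    by blast
  then show ?thesis by (simp add: critical_heights_map_def)
qed

end

theory Submission
  imports Defs
begin

text \<open>
  Parametrize monic centered polynomials by their critical points \<open>x\<^sub>0, \<dots>, x\<^sub>m\<^sub>-\<^sub>1\<close> (with sum \<open>0\<close>,
  where \<open>m = d - 1\<close>) and constant term \<open>x\<^sub>m\<close>. This parametrization is proper, hence a quotient map, so
  continuity and properness may be checked on parameters. Continuity holds because the escape rate is
  a locally uniform limit and the sorted list of heights is 1-Lipschitz in the sup norm.

  Properness: with weights \<open>1\<close> for the critical points and \<open>d\<close> for the constant term, the critical
  values are homogeneous of degree \<open>d\<close>, and they vanish simultaneously only at the origin. By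
  compactness some critical value is at least of size \<open>r^d\<close> up to a constant, where \<open>r\<close> is the size of
  the parameter, while the escape radius is only of size \<open>r\<close>. So bounded heights bound \<open>r\<close>.

  Surjectivity is achieved by real polynomials with real critical points in an interval \<open>[0, b]\<close> such
  that \<open>b\<close> is fixed, \<open>0\<close> is sent to \<open>0\<close> or \<open>b\<close>, and the critical values lie alternately above \<open>b\<close> and
  below \<open>0\<close>. The distances of the critical values from \<open>[0, b]\<close> can be chosen to realize any escape
  rates, by the Poincare-Miranda theorem.
\<close>

subsection \<open>Product spaces and the Poincare-Miranda theorem\<close>

text \<open>Tychonoff's theorem for the product topology that the function type carries.\<close>

lemma compact_box_fun:
  fixes S :: "nat \<Rightarrow> 'a::topological_space set"
  assumes "\<And>i. compact (S i)"
  shows "compact {y. \<forall>i. y i \<in> S i}"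
proof -
  have "compactin (product_topology (\<lambda>_. euclidean) UNIV) (PiE UNIV S)"
    using assms by (simp add: compactin_PiE)
  moreover have "PiE UNIV S = {y. \<forall>i. y i \<in> S i}"
    by auto
  ultimately show ?thesis
    by (simp add: euclidean_product_topology)
qed

lemma tendsto_fun_iff:
  fixes f :: "'a \<Rightarrow> nat \<Rightarrow> 'b::topological_space"
  shows "(f \<longlongrightarrow> l) F \<longleftrightarrow> (\<forall>i. ((\<lambda>x. f x i) \<longlongrightarrow> l i) F)"
  using limitin_componentwise[of "\<lambda>_. euclidean" UNIV f l F]
  by (simp add: euclidean_product_topology)

text \<open>Divide the cube into cells of mesh \<open>1 / Suc p\<close> and label the vertices by
  the signs of the \<open>F i\<close>. Kuhn's lemma yields a cell on which every \<open>F i\<close>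
  takes both signs in the weak sense, and by compactness such cells accumulate at a common zero.
  Setting the coordinates from \<open>n\<close> on to 0 makes \<open>Q\<close> a compact subset of
  the function type.\<close>

lemma poincare_miranda:
  fixes F :: "nat \<Rightarrow> (nat \<Rightarrow> real) \<Rightarrow> real" and n :: nat
  defines "Q \<equiv> {y. (\<forall>i<n. 0 \<le> y i \<and> y i \<le> 1) \<and> (\<forall>i\<ge>n. y i = 0)}"
  assumes cont: "\<And>i. i < n \<Longrightarrow> continuous_on Q (F i)"
    and lo: "\<And>i y. i < n \<Longrightarrow> y \<in> Q \<Longrightarrow> y i = 0 \<Longrightarrow> F i y \<le> 0"
    and hi: "\<And>i y. i < n \<Longrightarrow> y \<in> Q \<Longrightarrow> y i = 1 \<Longrightarrow> F i y \<ge> 0"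
  shows "\<exists>y\<in>Q. \<forall>i<n. F i y = 0"
proof -
  define sc where "sc p x = (\<lambda>i. if i < n then real (x i) / real (Suc p) else 0)"
    for p :: nat and x :: "nat \<Rightarrow> nat"
  have scQ: "sc p x \<in> Q" if "\<forall>j<n. x j \<le> Suc p" for p x
    using that by (auto simp: sc_def Q_def field_simps)
  define P where "P p y r s \<longleftrightarrow> y \<in> Q \<and> (\<forall>i<n. r i \<in> Q \<and> s i \<in> Q \<and> F i (r i) \<le> 0 \<and> 0 \<le> F i (s i) \<and>
      (\<forall>j. \<bar>r i j - y j\<bar> \<le> 1 / real (Suc p) \<and> \<bar>s i j - y j\<bar> \<le> 1 / real (Suc p)))"
    for p :: nat and y :: "nat \<Rightarrow> real" and r s :: "nat \<Rightarrow> nat \<Rightarrow> real"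
  have "\<exists>y r s. P p y r s" for p
  proof -
    \<comment> \<open>The label records the sign of \<open>F i\<close>, except on the faces, where
      Kuhn's lemma prescribes it; by \<open>lo\<close> and \<open>hi\<close> the prescribed label
      still agrees with the sign.\<close>
    define label where "label x i = (if x i = Suc p then 1 else if x i = 0 then 0
        else if F i (sc p x) \<le> 0 then 0 else (1::nat))" for x :: "nat \<Rightarrow> nat" and i
    have lab: "F i (sc p x) \<le> 0" if "label x i = 0" "i < n" "\<forall>j<n. x j \<le> Suc p" for x i
      using that lo[OF that(2) scQ[OF that(3)]] by (auto simp: label_def sc_def split: if_splits)
    have lab': "F i (sc p x) \<ge> 0" if "label x i \<noteq> 0" "i < n" "\<forall>j<n. x j \<le> Suc p" for x i
      using that hi[OF that(2) scQ[OF that(3)]] by (auto simp: label_def sc_def split: if_splits)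
    \<comment> \<open>\<open>q\<close> is the lowest corner of a cell that has, for each
      \<open>i\<close>, two vertices with different \<open>i\<close>-th labels.\<close>
    obtain q where q: "\<forall>i<n. q i < Suc p"
      and ex: "\<forall>i<n. \<exists>r s. (\<forall>j<n. q j \<le> r j \<and> r j \<le> q j + 1) \<and>
             (\<forall>j<n. q j \<le> s j \<and> s j \<le> q j + 1) \<and> label r i \<noteq> label s i"
      by (rule kuhn_lemma[of "Suc p" n label]) (auto simp: label_def)
    have near: "\<bar>sc p r j - sc p q j\<bar> \<le> 1 / real (Suc p)" if "\<forall>j<n. q j \<le> r j \<and> r j \<le> q j + 1" for r j
    proof (cases "j < n")
      case True
      then have "real (q j) \<le> real (r j)" "real (r j) \<le> real (q j) + 1"
        using that by auto
      then show ?thesis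
        using True by (simp add: sc_def abs_le_iff divide_simps)
    qed (simp add: sc_def)
    have "\<exists>r s. r \<in> Q \<and> s \<in> Q \<and> F i r \<le> 0 \<and> 0 \<le> F i s \<and>
        (\<forall>j. \<bar>r j - sc p q j\<bar> \<le> 1 / real (Suc p) \<and> \<bar>s j - sc p q j\<bar> \<le> 1 / real (Suc p))"
      if "i < n" for i
    proof -
      obtain r s where rs: "\<forall>j<n. q j \<le> r j \<and> r j \<le> q j + 1"
          "\<forall>j<n. q j \<le> s j \<and> s j \<le> q j + 1" "label r i \<noteq> label s i"
        using ex \<open>i < n\<close> by blast
      have b: "\<forall>j<n. r j \<le> Suc p" "\<forall>j<n. s j \<le> Suc p"
        using rs q by fastforce+
      show ?thesis
      proof (cases "label r i = 0")
        case True
        then show ?thesis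
          using lab[of r i] lab'[of s i] b rs that near scQ
          by (intro exI[of _ "sc p r"] exI[of _ "sc p s"]) auto
      next
        case False
        then have "label s i = 0"
          using rs(3) by (auto simp: label_def split: if_splits)
        then show ?thesis
          using False lab[of s i] lab'[of r i] b rs that near scQ
          by (intro exI[of _ "sc p s"] exI[of _ "sc p r"]) auto
      qed
    qed
    then obtain r s where "\<And>i. i < n \<Longrightarrow> r i \<in> Q \<and> s i \<in> Q \<and> F i (r i) \<le> 0 \<and> 0 \<le> F i (s i) \<and>
        (\<forall>j. \<bar>r i j - sc p q j\<bar> \<le> 1 / real (Suc p) \<and> \<bar>s i j - sc p q j\<bar> \<le> 1 / real (Suc p))"
      by metis
    moreover have "sc p q \<in> Q"
      using q by (intro scQ) (auto intro: less_imp_le)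
    ultimately show ?thesis
      unfolding P_def by blast
  qed
  then obtain y r s where P: "\<And>p. P p (y p) (r p) (s p)"
    by metis
  have "compact {y :: nat \<Rightarrow> real. \<forall>i. y i \<in> (if i < n then {0..1} else {0})}"
    by (rule compact_box_fun) auto
  also have "{y :: nat \<Rightarrow> real. \<forall>i. y i \<in> (if i < n then {0..1} else {0})} = Q"
    by (force simp: Q_def if_split_mem2 not_less)
  finally have "seq_compact Q"
    by (simp add: compact_imp_seq_compact)
  moreover have "\<forall>p. y p \<in> Q"
    using P by (auto simp: P_def)
  ultimately obtain l k where l: "l \<in> Q" and k: "strict_mono k" "(y \<circ> k) \<longlonglongrightarrow> l"
    by (rule seq_compactE)
  have inv: "(\<lambda>p. 1 / real (Suc (k p))) \<longlonglongrightarrow> 0"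
    using LIMSEQ_subseq_LIMSEQ[OF LIMSEQ_inverse_real_of_nat k(1)]
    by (simp add: o_def inverse_eq_divide)
  have conv: "(\<lambda>p. u (k p)) \<longlonglongrightarrow> l"
    if "\<And>p j. \<bar>u p j - y p j\<bar> \<le> 1 / real (Suc p)" for u :: "nat \<Rightarrow> nat \<Rightarrow> real"
    unfolding tendsto_fun_iff
  proof
    fix j
    have "(\<lambda>p. u (k p) j - y (k p) j) \<longlonglongrightarrow> 0"
      by (rule Lim_null_comparison[OF _ inv]) (use that in auto)
    moreover have "(\<lambda>p. y (k p) j) \<longlonglongrightarrow> l j"
      using k(2) by (simp add: tendsto_fun_iff o_def)
    ultimately show "(\<lambda>p. u (k p) j) \<longlonglongrightarrow> l j"
      using tendsto_add by fastforce
  qed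
  have "F i l = 0" if "i < n" for i
  proof (rule antisym)
    have "(\<lambda>p. F i (r (k p) i)) \<longlonglongrightarrow> F i l"
      by (rule continuous_on_tendsto_compose[OF cont[OF that]])
        (use P that l in \<open>auto simp: P_def intro!: conv\<close>)
    then show "F i l \<le> 0"
      by (rule LIMSEQ_le_const2) (use P that in \<open>auto simp: P_def\<close>)
    have "(\<lambda>p. F i (s (k p) i)) \<longlonglongrightarrow> F i l"
      by (rule continuous_on_tendsto_compose[OF cont[OF that]])
        (use P that l in \<open>auto simp: P_def intro!: conv\<close>)
    then show "0 \<le> F i l"
      by (rule LIMSEQ_le_const) (use P that in \<open>auto simp: P_def\<close>)
  qed
  then show ?thesis
    using l by blast
qed

subsection \<open>Polynomials with given critical points\<close>

text \<open>
  Up to centering, \<open>crit_poly m x\<close> is the general monic polynomial of degree \<open>Suc m\<close>, parametrized by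
  its critical points \<open>x 0, \<dots>, x (m - 1)\<close> and its constant term \<open>x m\<close>.
\<close>

definition crit_prod :: "nat \<Rightarrow> (nat \<Rightarrow> complex) \<Rightarrow> complex poly" where
  "crit_prod m x = (\<Prod>j<m. [:- x j, 1:])"

definition crit_poly :: "nat \<Rightarrow> (nat \<Rightarrow> complex) \<Rightarrow> complex poly" where
  "crit_poly m x = pCons (x m)
     (\<Sum>i\<le>m. monom (of_nat (Suc m) / of_nat (Suc i) * coeff (crit_prod m x) i) i)"

lemma crit_prod_Suc: "crit_prod (Suc m) x = crit_prod m x * [:- x m, 1:]"
  by (simp add: crit_prod_def)

lemma coeff_mult_linear:
  "coeff (p * [:- c, 1:]) k = (if k = 0 then 0 else coeff p (k - 1)) - c * coeff p k"
  for p :: "complex poly"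
  by (cases k) (simp_all add: mult.commute[of p])

lemma degree_crit_prod: "degree (crit_prod m x) = m"
  and lead_coeff_crit_prod: "coeff (crit_prod m x) m = 1"
proof -
  show "degree (crit_prod m x) = m"
    unfolding crit_prod_def by (subst degree_prod_sum_eq) auto
  moreover have "lead_coeff (crit_prod m x) = 1"
    by (simp add: crit_prod_def lead_coeff_prod)
  ultimately show "coeff (crit_prod m x) m = 1"
    by simp
qed

lemma crit_prod_nonzero [simp]: "crit_prod m x \<noteq> 0"
  using lead_coeff_crit_prod[of m x] by auto

lemma poly_crit_prod: "poly (crit_prod m x) z = (\<Prod>j<m. z - x j)"
  by (simp add: crit_prod_def poly_prod)

lemma coeff_crit_poly_0: "coeff (crit_poly m x) 0 = x m"
  by (simp add: crit_poly_def)

lemma coeff_crit_poly_Suc: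
  "coeff (crit_poly m x) (Suc i) = of_nat (Suc m) / of_nat (Suc i) * coeff (crit_prod m x) i"
proof -
  have "coeff (crit_prod m x) i = 0" if "i > m"
    using that by (simp add: coeff_eq_0 degree_crit_prod)
  then show ?thesis
    by (auto simp: crit_poly_def coeff_sum)
qed

lemma degree_crit_poly: "degree (crit_poly m x) = Suc m"
  and lead_coeff_crit_poly: "coeff (crit_poly m x) (Suc m) = 1"
proof -
  show 1: "coeff (crit_poly m x) (Suc m) = 1"
    unfolding coeff_crit_poly_Suc using lead_coeff_crit_prod
    by (simp add: of_nat_Suc[symmetric] del: of_nat_Suc)
  show "degree (crit_poly m x) = Suc m"
  proof (rule antisym)
    show "degree (crit_poly m x) \<le> Suc m"
    proof (rule degree_le, safe)
      fix i assume "Suc m < i"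
      then obtain j where "i = Suc j" "j > m"
        by (cases i) auto
      then show "coeff (crit_poly m x) i = 0"
        by (simp add: coeff_crit_poly_Suc coeff_eq_0 degree_crit_prod)
    qed
    show "Suc m \<le> degree (crit_poly m x)"
      using 1 by (intro le_degree) simp
  qed
qed

text \<open>\<open>crit_poly\<close> integrates \<open>crit_prod\<close> termwise; the factor
  \<open>Suc m\<close> keeps the result monic.\<close>

lemma pderiv_crit_poly: "pderiv (crit_poly m x) = smult (of_nat (Suc m)) (crit_prod m x)"
  by (rule poly_eqI) (simp add: coeff_pderiv coeff_crit_poly_Suc del: of_nat_Suc)

lemma poly_crit_poly_0: "poly (crit_poly m x) 0 = x m"
  by (simp add: poly_0_coeff_0 coeff_crit_poly_0)

lemma proots_pderiv_crit_poly: "proots (pderiv (crit_poly m x)) = image_mset x (mset_set {..<m})"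
proof -
  have "proots (crit_prod m x) = image_mset x (mset_set {..<m})"
  proof (induction m)
    case (Suc m)
    have "proots (crit_prod (Suc m) x) = proots (crit_prod m x) + proots [:- x m, 1:]"
      unfolding crit_prod_Suc by (rule proots_mult) auto
    then show ?case
      using Suc by (simp add: lessThan_Suc)
  qed (simp add: crit_prod_def)
  then show ?thesis
    by (simp add: pderiv_crit_poly del: of_nat_Suc)
qed

lemma poly_eqI_pderiv:
  fixes p q :: "complex poly"
  assumes "pderiv p = pderiv q" "coeff p 0 = coeff q 0"
  shows "p = q"
proof -
  have "pderiv (p - q) = 0"
    using assms by (simp add: pderiv_diff)
  then have "degree (p - q) = 0"
    by (simp add: pderiv_eq_0_iff)
  then obtain c where "p - q = [:c:]"
    by (meson degree_eq_zeroE)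
  moreover have "coeff (p - q) 0 = 0"
    using assms by simp
  ultimately show ?thesis by simp
qed

text \<open>Slot \<open>m\<close> of the parameter is free for the constant term because
  \<open>crit_prod\<close> reads only the slots below \<open>m\<close>.\<close>

lemma crit_poly_unique:
  assumes "pderiv f = smult (of_nat (Suc m)) (crit_prod m x)"
  shows "f = crit_poly m (x(m := coeff f 0))"
proof (rule poly_eqI_pderiv)
  have "crit_prod m (x(m := coeff f 0)) = crit_prod m x"
    unfolding crit_prod_def by (rule prod.cong) auto
  then show "pderiv f = pderiv (crit_poly m (x(m := coeff f 0)))"
    using assms by (simp add: pderiv_crit_poly)
qed (simp add: coeff_crit_poly_0)

text \<open>Weighted homogeneity: as polynomials in \<open>z\<close>, both sides have the same
  derivative and the same constant term.\<close>

lemma crit_poly_scale: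
  "poly (crit_poly m (\<lambda>i. if i < m then r * y i else r ^ Suc m * y i)) (r * z)
    = r ^ Suc m * poly (crit_poly m y) z"
proof -
  let ?x = "\<lambda>i. if i < m then r * y i else r ^ Suc m * y i"
  have *: "pcompose (crit_prod m ?x) [:0, r:] = smult (r ^ m) (crit_prod m y)"
  proof -
    have "(\<Prod>j<m. r * w - ?x j) = (\<Prod>j<m. r * (w - y j))" for w
      by (rule prod.cong) (auto simp: algebra_simps)
    then have "poly (pcompose (crit_prod m ?x) [:0, r:]) w = poly (smult (r ^ m) (crit_prod m y)) w" for w
      by (simp add: poly_pcompose poly_crit_prod prod.distrib mult.commute[of w])
    then show ?thesis
      by (simp add: poly_eq_poly_eq_iff[symmetric] fun_eq_iff)
  qed
  have "pcompose (crit_poly m ?x) [:0, r:] = smult (r ^ Suc m) (crit_poly m y)"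
  proof (rule poly_eqI_pderiv)
    have "pderiv (pcompose (crit_poly m ?x) [:0, r:])
        = smult (of_nat (Suc m)) (pcompose (crit_prod m ?x) [:0, r:]) * [:r:]"
      unfolding pderiv_pcompose pderiv_crit_poly pcompose_smult * by (simp only: pderiv_pCons pderiv_0) simp
    also have "\<dots> = pderiv (smult (r ^ Suc m) (crit_poly m y))"
      unfolding * pderiv_smult pderiv_crit_poly by (simp add: mult.commute mult.left_commute)
    finally show "pderiv (pcompose (crit_poly m ?x) [:0, r:]) = pderiv (smult (r ^ Suc m) (crit_poly m y))" .
    show "coeff (pcompose (crit_poly m ?x) [:0, r:]) 0 = coeff (smult (r ^ Suc m) (crit_poly m y)) 0"
      unfolding poly_0_coeff_0[symmetric] poly_pcompose by (simp add: coeff_crit_poly_0 poly_0_coeff_0)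
  qed
  from arg_cong[OF this, of "\<lambda>p. poly p z"] show ?thesis
    by (simp add: poly_pcompose mult.commute)
qed

section \<open>Continuity and size estimates in the parameters\<close>

lemma continuous_on_coeff_crit_prod:
  assumes "\<And>j. j < m \<Longrightarrow> continuous_on S (\<lambda>s. x s j)"
  shows "continuous_on S (\<lambda>s. coeff (crit_prod m (x s)) k)"
  using assms
proof (induction m arbitrary: k)
  case 0
  then show ?case by (simp add: crit_prod_def)
next
  case (Suc m)
  show ?case
    unfolding crit_prod_Suc coeff_mult_linear
    by (cases k) (auto intro!: continuous_intros Suc)
qed

lemma continuous_on_coeff_crit_poly:
  assumes "\<And>j. j \<le> m \<Longrightarrow> continuous_on S (\<lambda>s. x s j)"
  shows "continuous_on S (\<lambda>s. coeff (crit_poly m (x s)) k)"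
  by (cases k)
    (auto simp: coeff_crit_poly_0 coeff_crit_poly_Suc divide_inverse simp del: of_nat_Suc
      intro!: continuous_on_mult_left continuous_on_mult_right continuous_on_coeff_crit_prod assms)

lemma continuous_on_poly_crit_poly:
  assumes "\<And>j. j \<le> m \<Longrightarrow> continuous_on S (\<lambda>s. x s j)" "continuous_on S z"
  shows "continuous_on S (\<lambda>s. poly (crit_poly m (x s)) (z s))"
  unfolding poly_altdef degree_crit_poly
  by (intro continuous_intros continuous_on_coeff_crit_poly assms)

text \<open>Up to sign, the coefficient is the elementary symmetric polynomial of degree
  \<open>m - k\<close> in \<open>m\<close> variables, which has \<open>m choose k\<close> monomials;
  Pascal's rule carries the induction.\<close>

lemma norm_coeff_crit_prod_le:
  assumes "\<And>j. j < m \<Longrightarrow> cmod (x j) \<le> r" "r \<ge> 0"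
  shows "cmod (coeff (crit_prod m x) k) \<le> real (m choose k) * r ^ (m - k)"
  using assms(1)
proof (induction m arbitrary: k)
  case 0
  then show ?case by (cases k) (simp_all add: crit_prod_def)
next
  case (Suc m)
  have IH: "cmod (coeff (crit_prod m x) k) \<le> real (m choose k) * r ^ (m - k)" for k
    using Suc by simp
  have xm: "cmod (x m) \<le> r"
    using Suc.prems by simp
  have 1: "cmod (x m * coeff (crit_prod m x) k) \<le> real (m choose k) * r ^ (Suc m - k)"
  proof -
    have "cmod (x m * coeff (crit_prod m x) k) \<le> r * (real (m choose k) * r ^ (m - k))"
      unfolding norm_mult using IH xm assms(2) by (intro mult_mono) auto
    also have "\<dots> = real (m choose k) * r ^ (Suc m - k)"
      by (cases "k \<le> m") (auto simp: Suc_diff_le)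
    finally show ?thesis .
  qed
  show ?case
  proof (cases k)
    case 0
    then show ?thesis
      using 1 unfolding crit_prod_Suc coeff_mult_linear by simp
  next
    case (Suc l)
    have "cmod (coeff (crit_prod (Suc m) x) k)
        \<le> cmod (coeff (crit_prod m x) l) + cmod (x m * coeff (crit_prod m x) k)"
      unfolding crit_prod_Suc coeff_mult_linear using Suc by (simp add: norm_triangle_ineq4)
    also have "\<dots> \<le> real (m choose l) * r ^ (m - l) + real (m choose k) * r ^ (Suc m - k)"
      using IH 1 by (intro add_mono)
    also have "\<dots> = real (Suc m choose k) * r ^ (Suc m - k)"
      using Suc by (simp add: algebra_simps)
    finally show ?thesis .
  qed
qed

text \<open>The majorant of a monic polynomial with critical points of modulus at most \<open>r\<close>
  and constant term of modulus at most \<open>r ^ Suc m\<close> is \<open>(w + r) ^ Suc m\<close>.\<close>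

lemma norm_crit_poly_diff_le:
  assumes "\<And>j. j < m \<Longrightarrow> cmod (x j) \<le> r" "cmod (x m) \<le> r ^ Suc m" "r \<ge> 0"
  shows "cmod (poly (crit_poly m x) z - z ^ Suc m) \<le> (cmod z + r) ^ Suc m - cmod z ^ Suc m"
proof -
  have c: "cmod (coeff (crit_poly m x) k) \<le> real (Suc m choose k) * r ^ (Suc m - k)" for k
  proof (cases k)
    case 0
    then show ?thesis using assms by (simp add: coeff_crit_poly_0)
  next
    case (Suc i)
    have "cmod (coeff (crit_poly m x) k)
        \<le> real (Suc m) / real (Suc i) * (real (m choose i) * r ^ (m - i))"
      unfolding Suc coeff_crit_poly_Suc norm_mult norm_divide norm_of_nat
      by (intro mult_left_mono norm_coeff_crit_prod_le assms) auto
    also have "\<dots> = real (Suc m choose k) * r ^ (Suc m - k)"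
    proof -
      have "real (Suc i) * real (Suc m choose Suc i) = real (Suc m) * real (m choose i)"
        by (metis Suc_times_binomial of_nat_mult)
      then have "real (Suc m) / real (Suc i) * real (m choose i) = real (Suc m choose Suc i)"
        by (simp add: field_simps del: binomial_Suc_Suc of_nat_Suc)
      then show ?thesis
        by (simp add: Suc mult.assoc[symmetric] del: binomial_Suc_Suc of_nat_Suc)
    qed
    finally show ?thesis .
  qed
  have "poly (crit_poly m x) z - z ^ Suc m = (\<Sum>k\<le>m. coeff (crit_poly m x) k * z ^ k)"
    by (simp add: poly_altdef degree_crit_poly lead_coeff_crit_poly)
  then have "cmod (poly (crit_poly m x) z - z ^ Suc m)
      \<le> (\<Sum>k\<le>m. cmod (coeff (crit_poly m x) k * z ^ k))"
    by (simp add: norm_sum)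
  also have "\<dots> \<le> (\<Sum>k\<le>m. real (Suc m choose k) * cmod z ^ k * r ^ (Suc m - k))"
  proof (rule sum_mono)
    fix k
    show "cmod (coeff (crit_poly m x) k * z ^ k) \<le> real (Suc m choose k) * cmod z ^ k * r ^ (Suc m - k)"
      using mult_right_mono[OF c[of k], of "cmod z ^ k"] by (simp add: norm_mult norm_power mult_ac)
  qed
  also have "\<dots> = (cmod z + r) ^ Suc m - cmod z ^ Suc m"
    unfolding binomial_ring[of "cmod z" r "Suc m"] by simp
  finally show ?thesis .
qed

text \<open>With \<open>y = r / M\<close>, Bernoulli's inequality bounds \<open>(1 - y) ^ d\<close>
  below by 2/3, and \<open>(1 + y) ^ d\<close> is at most the reciprocal of that power.\<close>

lemma add_power_le:
  fixes r M :: real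
  assumes "r > 0" "3 * real d * r \<le> M"
  shows "(M + r) ^ d \<le> 3 / 2 * M ^ d"
proof (cases "d = 0")
  case False
  have M: "M > 0" "3 * real d * r > 0"
    using assms False by (auto intro: less_le_trans[of 0 "3 * real d * r"])
  define y where "y = r / M"
  have y: "0 < y" "real d * y \<le> 1 / 3"
    using M assms by (auto simp: y_def field_simps)
  have "y \<le> real d * y"
    using False y(1) by simp
  then have y1: "y < 1" using y(2) by simp
  have "1 - real d * y \<le> (1 - y) ^ d"
    using Bernoulli_inequality[of "-y" d] y1 by simp
  then have "2 / 3 \<le> (1 - y) ^ d" using y(2) by simp
  moreover have "(1 + y) ^ d * (1 - y) ^ d \<le> 1"
  proof -
    have "(1 + y) * (1 - y) \<le> 1" "0 \<le> (1 + y) * (1 - y)"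
      using y y1 mult_mono[of y 1 y 1] by (simp_all add: algebra_simps)
    then show ?thesis
      unfolding power_mult_distrib[symmetric] by (rule power_le_one[rotated])
  qed
  ultimately have "(1 + y) ^ d * (2 / 3) \<le> 1"
    using y(1) by (intro order_trans[OF mult_left_mono[of "2/3" "(1 - y) ^ d" "(1 + y) ^ d"]]) auto
  then have "(1 + y) ^ d \<le> 3 / 2" by simp
  moreover have "M + r = M * (1 + y)"
    using M by (simp add: y_def field_simps)
  ultimately show ?thesis
    using M by (simp add: power_mult_distrib mult.commute)
qed simp

text \<open>Beyond \<open>\<rho>\<close> the majorant keeps the lower terms below half of the
  leading term. What matters for properness is that \<open>\<rho>\<close> is linear in
  \<open>r\<close>.\<close>

lemma crit_poly_bounds:
  assumes "\<And>j. j < m \<Longrightarrow> cmod (x j) \<le> r" "cmod (x m) \<le> r ^ Suc m" "r > 0"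
  defines "\<rho> \<equiv> 3 * real (Suc m) * r"
  shows "\<rho> \<le> cmod z \<Longrightarrow> cmod z ^ Suc m / 2 \<le> cmod (poly (crit_poly m x) z)"
    and "cmod (poly (crit_poly m x) z) \<le> 2 * max \<rho> (cmod z) ^ Suc m"
proof -
  let ?f = "poly (crit_poly m x) z"
  have d: "cmod (?f - z ^ Suc m) \<le> (cmod z + r) ^ Suc m - cmod z ^ Suc m"
    by (rule norm_crit_poly_diff_le) (use assms in auto)
  show "cmod z ^ Suc m / 2 \<le> cmod ?f" if "\<rho> \<le> cmod z"
  proof -
    have "(cmod z + r) ^ Suc m \<le> 3 / 2 * cmod z ^ Suc m"
      using that assms by (intro add_power_le) auto
    moreover have "cmod (z ^ Suc m) - cmod ?f \<le> cmod (?f - z ^ Suc m)"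
      by (metis norm_minus_commute norm_triangle_ineq2)
    ultimately show ?thesis
      using d unfolding norm_power by argo
  qed
  have "cmod ?f \<le> cmod (?f - z ^ Suc m) + cmod (z ^ Suc m)"
    by (metis diff_add_cancel norm_triangle_ineq)
  then have "cmod ?f \<le> (cmod z + r) ^ Suc m"
    using d unfolding norm_power by argo
  also have "\<dots> \<le> (max \<rho> (cmod z) + r) ^ Suc m"
    using assms by (intro power_mono) auto
  also have "\<dots> \<le> 3 / 2 * max \<rho> (cmod z) ^ Suc m"
    using assms by (intro add_power_le) auto
  also have "\<dots> \<le> 2 * max \<rho> (cmod z) ^ Suc m"
    using assms by (intro mult_right_mono) (auto intro!: zero_le_power simp: le_max_iff_disj)
  finally show "cmod ?f \<le> 2 * max \<rho> (cmod z) ^ Suc m" .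
qed

subsection \<open>Escape rates\<close>

text \<open>A telescoping geometric series. The explicit rate makes the convergence uniform over
  families with the same \<open>C\<close>.\<close>

lemma geometric_step_limit:
  fixes X :: "nat \<Rightarrow> real"
  assumes "\<And>n. \<bar>X (Suc n) - X n\<bar> \<le> C * (1 / 2) ^ Suc n"
  obtains L where "X \<longlonglongrightarrow> L" "\<And>n. \<bar>X n - L\<bar> \<le> C * (1 / 2) ^ n"
proof -
  have tail: "\<bar>X (n + k) - X n\<bar> \<le> C * (1 / 2) ^ n - C * (1 / 2) ^ (n + k)" for n k
  proof (induction k)
    case (Suc k)
    then show ?case
      using assms[of "n + k"] by (simp add: abs_if split: if_splits)
  qed simp
  have C: "C \<ge> 0"
    using order_trans[OF abs_ge_zero assms[of 0]] by simp
  have tail': "\<bar>X k - X n\<bar> \<le> C * (1 / 2) ^ n" if "n \<le> k" for n k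
  proof -
    have "C * (1 / 2) ^ k \<ge> 0" using C by simp
    then show ?thesis
      using tail[of n "k - n"] that by simp
  qed
  have lim0: "(\<lambda>n. C * (1 / 2) ^ n) \<longlonglongrightarrow> 0"
    by (intro tendsto_mult_right_zero LIMSEQ_power_zero) auto
  have "Cauchy X"
  proof (rule metric_CauchyI)
    fix e :: real assume "e > 0"
    then obtain N where N: "\<And>n. n \<ge> N \<Longrightarrow> C * (1 / 2) ^ n < e / 2"
      using order_tendstoD(2)[OF lim0, of "e / 2"] by (auto simp: eventually_sequentially)
    have "dist (X m) (X n) < e" if "m \<ge> N" "n \<ge> N" for m n
      using tail'[of N m] tail'[of N n] N[of N] that by (auto simp: dist_real_def)
    then show "\<exists>M. \<forall>m\<ge>M. \<forall>n\<ge>M. dist (X m) (X n) < e" by blast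
  qed
  then obtain L where L: "X \<longlonglongrightarrow> L"
    by (auto simp: Cauchy_convergent_iff convergent_def)
  have "\<bar>X n - L\<bar> \<le> C * (1 / 2) ^ n" for n
  proof (rule LIMSEQ_le_const2)
    show "(\<lambda>k. \<bar>X n - X k\<bar>) \<longlonglongrightarrow> \<bar>X n - L\<bar>"
      by (intro tendsto_intros L)
    show "\<exists>N. \<forall>k\<ge>N. \<bar>X n - X k\<bar> \<le> C * (1 / 2) ^ n"
      using tail'[of n] by (auto simp: abs_minus_commute)
  qed
  then show thesis using L that by blast
qed

lemma ln_plus_eq: "max 0 (ln x) = ln (max 1 x)" if "x \<ge> 0" for x :: real
  using that by (cases "x = 0") (auto simp: max_def)

definition log_orbit :: "complex poly \<Rightarrow> nat \<Rightarrow> complex \<Rightarrow> real" where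
  "log_orbit f n z = max 0 (ln (cmod ((poly f ^^ n) z))) / real (degree f) ^ n"

text \<open>The estimates in this locale depend on \<open>f\<close> only through its degree and
  \<open>\<rho>\<close>, so they are uniform over polynomials of one degree with a common radius.
  The bound \<open>\<rho> \<ge> 2\<close> absorbs the factor 1/2 in \<open>lower\<close>, so that no
  point outside the radius moves inward.\<close>

locale escape_radius =
  fixes f :: "complex poly" and \<rho> :: real
  assumes degree_ge_2: "degree f \<ge> 2"
    and radius_ge_2: "\<rho> \<ge> 2"
    and lower: "\<And>z. \<rho> \<le> cmod z \<Longrightarrow> cmod z ^ degree f / 2 \<le> cmod (poly f z)"
    and upper: "\<And>z. cmod (poly f z) \<le> 2 * max \<rho> (cmod z) ^ degree f"
begin

abbreviation "d \<equiv> degree f"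

lemma escapes: "cmod z \<le> cmod (poly f z)" if "\<rho> \<le> cmod z"
proof -
  have "cmod z * 2 \<le> cmod z * cmod z"
    using that radius_ge_2 by (intro mult_left_mono) auto
  also have "\<dots> \<le> cmod z ^ d"
    using power_increasing[of 2 d "cmod z"] degree_ge_2 that radius_ge_2
    by (simp add: power2_eq_square)
  finally show ?thesis
    using lower[OF that] by simp
qed

text \<open>Outside the radius the two-sided bounds give an error of at most \<open>ln 2\<close>;
  inside it both terms are nonnegative and at most the right-hand side.\<close>

lemma ln_plus_step:
  "\<bar>max 0 (ln (cmod (poly f z))) - real d * max 0 (ln (cmod z))\<bar> \<le> ln 2 + real d * ln \<rho>"
proof (cases "\<rho> \<le> cmod z")
  case True
  have z: "cmod z \<ge> 2" using True radius_ge_2 by simp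
  then have nz: "z \<noteq> 0" by auto
  have fz: "cmod (poly f z) \<ge> 2" using escapes[OF True] z by simp
  have "ln (cmod (poly f z)) \<le> ln (2 * cmod z ^ d)"
    using upper[of z] True fz by (intro ln_mono) (auto simp: max_def)
  also have "\<dots> = ln 2 + real d * ln (cmod z)"
    using nz by (subst ln_mult_pos) (auto simp: ln_realpow)
  finally have 1: "ln (cmod (poly f z)) \<le> ln 2 + real d * ln (cmod z)" .
  have "ln (cmod z ^ d / 2) \<le> ln (cmod (poly f z))"
    using lower[OF True] z zero_less_power[of "cmod z" d] by (intro ln_mono) linarith+
  also have "ln (cmod z ^ d / 2) = real d * ln (cmod z) - ln 2"
    using nz by (subst ln_divide_pos) (auto simp: ln_realpow)
  finally have 2: "real d * ln (cmod z) - ln 2 \<le> ln (cmod (poly f z))" .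
  have "real d * ln \<rho> \<ge> 0" using radius_ge_2 by simp
  then show ?thesis
    using 1 2 z fz by (simp add: max_def abs_le_iff)
next
  case False
  have "max 0 (ln (cmod z)) \<le> ln \<rho>"
    unfolding ln_plus_eq[OF norm_ge_zero] using False radius_ge_2 by (intro ln_mono) auto
  then have 1: "real d * max 0 (ln (cmod z)) \<le> real d * ln \<rho>"
    by (intro mult_left_mono) auto
  have "1 * 1 \<le> 2 * \<rho> ^ d"
    using radius_ge_2 by (intro mult_mono one_le_power) auto
  then have "max 0 (ln (cmod (poly f z))) \<le> ln (2 * \<rho> ^ d)"
    unfolding ln_plus_eq[OF norm_ge_zero] using False upper[of z]
    by (intro ln_mono) (auto simp: max_def)
  also have "\<dots> = ln 2 + real d * ln \<rho>"
    using radius_ge_2 by (subst ln_mult_pos) (auto simp: ln_realpow)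
  finally have 2: "max 0 (ln (cmod (poly f z))) \<le> ln 2 + real d * ln \<rho>" .
  have 3: "0 \<le> real d * max 0 (ln (cmod z))" "0 \<le> max 0 (ln (cmod (poly f z)))" "0 \<le> ln (2::real)"
    by auto
  show ?thesis using 1 2 3 by linarith
qed

lemma log_orbit_step:
  "\<bar>log_orbit f (Suc n) z - log_orbit f n z\<bar> \<le> (ln 2 + real d * ln \<rho>) * (1 / 2) ^ Suc n"
proof -
  let ?C = "ln 2 + real d * ln \<rho>" and ?w = "(poly f ^^ n) z"
  have C: "?C \<ge> 0" using radius_ge_2 by simp
  have d: "real d \<ge> 2" using degree_ge_2 by simp
  have "\<bar>log_orbit f (Suc n) z - log_orbit f n z\<bar>
      = \<bar>max 0 (ln (cmod (poly f ?w))) - real d * max 0 (ln (cmod ?w))\<bar> / real d ^ Suc n"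
  proof -
    have "log_orbit f (Suc n) z - log_orbit f n z
        = (max 0 (ln (cmod (poly f ?w))) - real d * max 0 (ln (cmod ?w))) / real d ^ Suc n"
      using d by (simp add: log_orbit_def diff_divide_distrib)
    then show ?thesis by (simp add: abs_divide)
  qed
  also have "\<dots> \<le> ?C / real d ^ Suc n"
    by (intro divide_right_mono ln_plus_step) auto
  also have "\<dots> \<le> ?C / 2 ^ Suc n"
    using C d by (intro divide_left_mono power_mono mult_pos_pos) auto
  finally show ?thesis
    by (simp add: power_divide)
qed

lemma escape_rate_limit: "(\<lambda>n. log_orbit f n z) \<longlonglongrightarrow> escape_rate f z"
  and log_orbit_uniform:
    "\<bar>log_orbit f n z - escape_rate f z\<bar> \<le> (ln 2 + real d * ln \<rho>) * (1 / 2) ^ n"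
proof -
  obtain L where L: "(\<lambda>n. log_orbit f n z) \<longlonglongrightarrow> L"
      "\<And>n. \<bar>log_orbit f n z - L\<bar> \<le> (ln 2 + real d * ln \<rho>) * (1 / 2) ^ n"
    using geometric_step_limit[of "\<lambda>n. log_orbit f n z", OF log_orbit_step] by blast
  have "escape_rate f z = L"
    unfolding escape_rate_def log_orbit_def[symmetric] by (rule limI[OF L(1)])
  then show "(\<lambda>n. log_orbit f n z) \<longlonglongrightarrow> escape_rate f z"
    and "\<bar>log_orbit f n z - escape_rate f z\<bar> \<le> (ln 2 + real d * ln \<rho>) * (1 / 2) ^ n"
    using L by auto
qed

lemma escape_rate_nonneg: "escape_rate f z \<ge> 0"
  by (rule LIMSEQ_le_const[OF escape_rate_limit]) (auto simp: log_orbit_def)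

lemma escape_rate_step: "escape_rate f (poly f z) = real d * escape_rate f z"
proof (rule LIMSEQ_unique[OF escape_rate_limit])
  have "log_orbit f n (poly f z) = real d * log_orbit f (Suc n) z" for n
    using degree_ge_2 by (simp add: log_orbit_def funpow_swap1)
  then show "(\<lambda>n. log_orbit f n (poly f z)) \<longlonglongrightarrow> real d * escape_rate f z"
    using LIMSEQ_Suc[OF escape_rate_limit] by (simp add: tendsto_mult_left)
qed

lemma escape_rate_fixed: "escape_rate f z = 0" if "poly f z = z"
  using escape_rate_step[of z] that degree_ge_2 by simp

text \<open>The division by 2 makes the bound reproduce itself: one step of \<open>upper\<close>
  costs a factor 2, while raising 1/2 to the power \<open>d \<ge> 2\<close> leaves at most
  1/4.\<close>

lemma orbit_le: "max \<rho> (cmod ((poly f ^^ n) z)) \<le> (2 * max \<rho> (cmod z)) ^ (d ^ n) / 2"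
proof (induction n)
  case (Suc n)
  let ?w = "(poly f ^^ n) z" and ?B = "2 * max \<rho> (cmod z)"
  have B: "?B \<ge> 1" using radius_ge_2 by simp
  have "\<rho> \<le> ?B ^ (d ^ n) / 2" using Suc by simp
  also have "\<dots> \<le> ?B ^ (d ^ Suc n) / 2"
    using B degree_ge_2 by (intro divide_right_mono power_increasing) auto
  finally have 1: "\<rho> \<le> ?B ^ (d ^ Suc n) / 2" .
  have "cmod (poly f ?w) \<le> 2 * (?B ^ (d ^ n) / 2) ^ d"
    using upper[of ?w] Suc radius_ge_2
    by (elim order_trans) (intro mult_left_mono power_mono, auto)
  also have "\<dots> = 2 * ?B ^ (d ^ Suc n) / 2 ^ d"
    unfolding power_divide power_mult[symmetric] by (simp only: power_Suc mult.commute times_divide_eq_right)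
  also have "\<dots> \<le> 2 * ?B ^ (d ^ Suc n) / 2 ^ 2"
    using degree_ge_2 B by (intro divide_left_mono power_increasing) auto
  finally show ?case using 1 by simp
qed simp

lemma escape_rate_le: "escape_rate f z \<le> ln (max \<rho> (cmod z)) + ln 2"
proof (rule LIMSEQ_le_const2[OF escape_rate_limit], intro exI allI impI)
  fix n :: nat
  let ?B = "2 * max \<rho> (cmod z)"
  have B: "?B > 0" using radius_ge_2 by simp
  have "max 1 (cmod ((poly f ^^ n) z)) \<le> max \<rho> (cmod ((poly f ^^ n) z))"
    using radius_ge_2 by auto
  also have "\<dots> \<le> ?B ^ (d ^ n)"
  proof -
    have "?B ^ (d ^ n) > 0" using B by (rule zero_less_power)
    then show ?thesis using orbit_le[of n z] by argo
  qed
  finally have "max 0 (ln (cmod ((poly f ^^ n) z))) \<le> ln (?B ^ (d ^ n))"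
    unfolding ln_plus_eq[OF norm_ge_zero] by (intro ln_mono) auto
  also have "\<dots> = real d ^ n * ln ?B"
    using B by (simp only: ln_realpow of_nat_power)
  finally have "log_orbit f n z \<le> ln ?B"
    using degree_ge_2 by (simp add: log_orbit_def field_simps)
  also have "\<dots> = ln (max \<rho> (cmod z)) + ln 2"
    using radius_ge_2 by (subst ln_mult_pos) auto
  finally show "log_orbit f n z \<le> ln (max \<rho> (cmod z)) + ln 2" .
qed

text \<open>Half the modulus of a point outside the radius is raised at least to the power
  \<open>d\<close> by each step, since \<open>d \<ge> 2\<close>; by \<open>escapes\<close> the orbit
  stays outside.\<close>

lemma orbit_ge:
  assumes "\<rho> \<le> cmod z"
  shows "\<rho> \<le> cmod ((poly f ^^ n) z) \<and> 2 * (cmod z / 2) ^ (d ^ n) \<le> cmod ((poly f ^^ n) z)"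
proof (induction n)
  case (Suc n)
  let ?w = "(poly f ^^ n) z"
  have 1: "\<rho> \<le> cmod (poly f ?w)"
    using escapes[of ?w] Suc by simp
  have "2 ^ 1 * (cmod z / 2) ^ (d ^ Suc n) \<le> 2 ^ (d - 1) * (cmod z / 2) ^ (d ^ Suc n)"
    using degree_ge_2 by (intro mult_right_mono power_increasing) auto
  also have "\<dots> = (2 * (cmod z / 2) ^ (d ^ n)) ^ d / 2"
  proof -
    have "(2::real) ^ d = 2 * 2 ^ (d - 1)"
      using degree_ge_2 by (cases d) auto
    then show ?thesis
      unfolding power_mult_distrib power_mult[symmetric] by (simp add: mult.commute)
  qed
  also have "\<dots> \<le> cmod ?w ^ d / 2"
    using Suc by (intro divide_right_mono power_mono) auto
  also have "\<dots> \<le> cmod (poly f ?w)"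
    using Suc by (intro lower) auto
  finally show ?case using 1 by simp
qed (use assms in simp)

lemma escape_rate_ge:
  assumes "\<rho> \<le> cmod z"
  shows "ln (cmod z) - ln 2 \<le> escape_rate f z"
proof (rule LIMSEQ_le_const[OF escape_rate_limit], intro exI allI impI)
  fix n :: nat
  have nz: "z \<noteq> 0" using assms radius_ge_2 by auto
  then have z: "cmod z / 2 > 0" by simp
  have p: "(cmod z / 2) ^ (d ^ n) > 0" using z by (rule zero_less_power)
  have "real d ^ n * ln (cmod z / 2) = ln ((cmod z / 2) ^ (d ^ n))"
    using z by (simp only: ln_realpow of_nat_power)
  also have "\<dots> \<le> ln (cmod ((poly f ^^ n) z))"
    using orbit_ge[OF assms, of n] p by (intro ln_mono) linarith+
  also have "\<dots> \<le> max 0 (ln (cmod ((poly f ^^ n) z)))" by simp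
  finally have "ln (cmod z / 2) \<le> log_orbit f n z"
    using degree_ge_2 by (simp add: log_orbit_def field_simps)
  then show "ln (cmod z) - ln 2 \<le> log_orbit f n z"
    using nz by (simp add: ln_divide_pos)
qed

end

lemma escape_radius_crit_poly:
  assumes "m \<ge> 1" "\<And>j. j < m \<Longrightarrow> cmod (x j) \<le> r" "cmod (x m) \<le> r ^ Suc m" "r \<ge> 1"
  shows "escape_radius (crit_poly m x) (3 * real (Suc m) * r)"
proof
  have "3 * 2 * 1 \<le> 3 * real (Suc m) * r"
    using assms by (intro mult_mono) auto
  then show "2 \<le> 3 * real (Suc m) * r" by simp
qed (use assms crit_poly_bounds[of m x r] in \<open>auto simp: degree_crit_poly simp del: of_nat_Suc power_Suc\<close>)

lemma continuous_on_log_orbit: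
  assumes "\<And>j. j \<le> m \<Longrightarrow> continuous_on S (\<lambda>s. x s j)" "continuous_on S z"
  shows "continuous_on S (\<lambda>s. log_orbit (crit_poly m (x s)) n (z s))"
proof -
  have "continuous_on S (\<lambda>s. (poly (crit_poly m (x s)) ^^ n) (z s))"
    by (induction n) (use assms in \<open>auto intro!: continuous_on_poly_crit_poly\<close>)
  then show ?thesis
    unfolding log_orbit_def ln_plus_eq[OF norm_ge_zero] degree_crit_poly
    by (intro continuous_intros) auto
qed

text \<open>Parameters bounded by \<open>r\<close> share the escape radius
  \<open>3 * Suc m * r\<close>, so the continuous functions \<open>log_orbit\<close> converge
  uniformly in parameter and point together.\<close>

lemma continuous_on_escape_rate_bounded:
  assumes "m \<ge> 1" "r \<ge> 1"
    and "\<And>s j. s \<in> S \<Longrightarrow> j < m \<Longrightarrow> cmod (x s j) \<le> r" "\<And>s. s \<in> S \<Longrightarrow> cmod (x s m) \<le> r ^ Suc m"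
    and "\<And>j. j \<le> m \<Longrightarrow> continuous_on S (\<lambda>s. x s j)" "continuous_on S z"
  shows "continuous_on S (\<lambda>s. escape_rate (crit_poly m (x s)) (z s))"
proof -
  define C where "C = ln 2 + real (Suc m) * ln (3 * real (Suc m) * r)"
  have bd: "\<bar>log_orbit (crit_poly m (x s)) n (z s) - escape_rate (crit_poly m (x s)) (z s)\<bar>
      \<le> C * (1 / 2) ^ n" if "s \<in> S" for s n
    using escape_radius.log_orbit_uniform[OF escape_radius_crit_poly[of m "x s" r]] assms that
    by (simp add: C_def degree_crit_poly del: of_nat_Suc)
  have lim0: "(\<lambda>n. C * (1 / 2) ^ n) \<longlonglongrightarrow> 0"
    by (intro tendsto_mult_right_zero LIMSEQ_power_zero) auto
  have "uniform_limit S (\<lambda>n s. log_orbit (crit_poly m (x s)) n (z s))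
      (\<lambda>s. escape_rate (crit_poly m (x s)) (z s)) sequentially"
  proof (rule uniform_limitI)
    fix e :: real assume "e > 0"
    then have "\<forall>\<^sub>F n in sequentially. C * (1 / 2) ^ n < e"
      by (rule order_tendstoD(2)[OF lim0])
    then show "\<forall>\<^sub>F n in sequentially. \<forall>s\<in>S. dist (log_orbit (crit_poly m (x s)) n (z s))
        (escape_rate (crit_poly m (x s)) (z s)) < e"
      by eventually_elim (use bd in \<open>auto simp: dist_real_def intro: le_less_trans\<close>)
  qed
  then show ?thesis
    by (rule uniform_limit_theorem[rotated])
      (auto intro!: always_eventually continuous_on_log_orbit assms)
qed

subsection \<open>Real polynomials with prescribed critical heights\<close>

lemma coeff_crit_prod_Reals:
  assumes "\<And>j. j < m \<Longrightarrow> x j \<in> \<real>"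
  shows "coeff (crit_prod m x) k \<in> \<real>"
  using assms
proof (induction m arbitrary: k)
  case 0
  then show ?case by (cases k) (simp_all add: crit_prod_def)
next
  case (Suc m)
  then show ?case
    unfolding crit_prod_Suc coeff_mult_linear by (auto intro!: Reals_diff Reals_mult)
qed

lemma poly_crit_poly_Reals:
  assumes "\<And>j. j \<le> m \<Longrightarrow> x j \<in> \<real>" "z \<in> \<real>"
  shows "poly (crit_poly m x) z \<in> \<real>"
proof -
  have "coeff (crit_poly m x) k \<in> \<real>" for k
  proof (cases k)
    case (Suc i)
    have "coeff (crit_prod m x) i \<in> \<real>"
      using assms by (intro coeff_crit_prod_Reals) auto
    then show ?thesis
      unfolding Suc coeff_crit_poly_Suc by (intro Reals_mult Reals_divide Reals_of_nat)
  qed (use assms in \<open>simp add: coeff_crit_poly_0\<close>)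
  then show ?thesis
    unfolding poly_altdef using assms(2) by (intro sum_in_Reals Reals_mult Reals_power) auto
qed

text \<open>Exactly the \<open>m - k\<close> factors with \<open>j \<ge> k\<close> are nonpositive.
  The zeros are \<open>c 1, ..., c m\<close>, hence the shift; \<open>c 0\<close> and
  \<open>c (Suc m)\<close> serve as outer endpoints.\<close>

lemma prod_diff_sign:
  fixes c :: "nat \<Rightarrow> real"
  assumes "mono c" "k \<le> m" "c k \<le> s" "s \<le> c (Suc k)"
  shows "(\<Prod>j<m. s - c (Suc j)) = (-1) ^ (m - k) * (\<Prod>j<m. \<bar>s - c (Suc j)\<bar>)"
proof -
  have 1: "s - c (Suc j) = (if j < k then 1 else -1) * \<bar>s - c (Suc j)\<bar>" for j
    using monoD[OF assms(1), of "Suc j" k] monoD[OF assms(1), of "Suc k" "Suc j"] assms(3,4)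
    by (cases "j < k") auto
  have "(\<Prod>j<m. if j < k then 1 else - 1 :: real) = (-1) ^ card ({..<m} - {..<k})"
    by (subst prod.If_cases) (auto simp: Diff_eq Collect_neg_eq lessThan_def)
  also have "{..<m} - {..<k} = {k..<m}" by auto
  finally have 2: "(\<Prod>j<m. if j < k then 1 else - 1 :: real) = (-1) ^ (m - k)" by simp
  have "(\<Prod>j<m. s - c (Suc j)) = (\<Prod>j<m. (if j < k then 1 else -1) * \<bar>s - c (Suc j)\<bar>)"
    using 1 by (intro prod.cong refl)
  also have "\<dots> = (-1) ^ (m - k) * (\<Prod>j<m. \<bar>s - c (Suc j)\<bar>)"
    by (simp only: prod.distrib 2)
  finally show ?thesis .
qed

text \<open>Between \<open>c k\<close> and \<open>c (Suc k)\<close> the polynomial is monotone, with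
  direction \<open>(-1) ^ (m - k)\<close>. On the middle third every critical point is at least
  \<open>R / 3\<close> away, which bounds the derivative below, and the mean value theorem applies.
  A wide gap thus forces a large jump.\<close>

lemma crit_poly_gap:
  fixes c :: "nat \<Rightarrow> real"
  assumes "mono c" "k \<le> m" "\<And>j. j < m \<Longrightarrow> x j = of_real (c (Suc j))"
  defines "\<phi> \<equiv> \<lambda>s. Re (poly (crit_poly m x) (of_real s))"
  defines "R \<equiv> c (Suc k) - c k"
  shows "real (Suc m) * (R / 3) ^ Suc m \<le> (-1) ^ (m - k) * (\<phi> (c (Suc k)) - \<phi> (c k))"
proof (cases "R = 0")
  case False
  then have R: "R > 0"
    using monoD[OF assms(1), of k "Suc k"] by (simp add: R_def)
  define p where "p s = (\<Prod>j<m. \<bar>s - c (Suc j)\<bar>)" for s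
  define \<psi> where "\<psi> s = (-1) ^ (m - k) * \<phi> s" for s
  have deriv: "(\<psi> has_real_derivative real (Suc m) * p s) (at s)" if "c k \<le> s" "s \<le> c (Suc k)" for s
  proof -
    have "((\<lambda>s. poly (crit_poly m x) (of_real s)) has_vector_derivative
        poly (pderiv (crit_poly m x)) (of_real s)) (at s)"
      by (rule has_vector_derivative_real_field) (rule poly_DERIV)
    then have "(\<phi> has_real_derivative Re (poly (pderiv (crit_poly m x)) (of_real s))) (at s)"
      unfolding \<phi>_def by (rule has_field_derivative_Re)
    also have "poly (pderiv (crit_poly m x)) (of_real s)
        = of_real (real (Suc m) * (\<Prod>j<m. s - c (Suc j)))"
      using assms(3) by (simp add: pderiv_crit_poly poly_crit_prod)
    finally have "(\<phi> has_real_derivative real (Suc m) * ((-1) ^ (m - k) * p s)) (at s)"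
      unfolding prod_diff_sign[OF assms(1,2) that] p_def by (simp only: Re_complex_of_real)
    then have "(\<psi> has_real_derivative (-1) ^ (m - k) * (real (Suc m) * ((-1) ^ (m - k) * p s))) (at s)"
      unfolding \<psi>_def by (rule DERIV_cmult)
    also have "(-1) ^ (m - k) * (real (Suc m) * ((-1) ^ (m - k) * p s))
        = ((-1) ^ (m - k) * (-1) ^ (m - k)) * (real (Suc m) * p s)"
      by (simp only: mult_ac)
    also have "\<dots> = real (Suc m) * p s"
      by (simp flip: power_add add: mult_2[symmetric])
    finally show ?thesis .
  qed
  have p0: "p s \<ge> 0" for s
    unfolding p_def by (intro prod_nonneg) auto
  have mono: "\<psi> u \<le> \<psi> v" if "c k \<le> u" "u \<le> v" "v \<le> c (Suc k)" for u v
  proof (rule DERIV_nonneg_imp_nondecreasing[OF that(2)])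
    fix s assume "u \<le> s" "s \<le> v"
    then show "\<exists>y. (\<psi> has_real_derivative y) (at s) \<and> 0 \<le> y"
      using that deriv[of s] p0[of s] by (intro exI[of _ "real (Suc m) * p s"]) auto
  qed
  define u where "u = c k + R / 3"
  define v where "v = c (Suc k) - R / 3"
  have uv: "c k \<le> u" "u < v" "v \<le> c (Suc k)" "v - u = R / 3"
    using R unfolding u_def v_def R_def by argo+
  obtain \<xi> where \<xi>: "u < \<xi>" "\<xi> < v" "\<psi> v - \<psi> u = (v - u) * (real (Suc m) * p \<xi>)"
    using MVT2[OF uv(2), of \<psi> "\<lambda>s. real (Suc m) * p s"] deriv uv by auto
  have "(\<Prod>j<m. R / 3) \<le> p \<xi>"
    unfolding p_def
  proof (rule prod_mono, safe)
    fix j assume "j < m"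
    show "R / 3 \<le> \<bar>\<xi> - c (Suc j)\<bar>"
    proof (cases "j < k")
      case True
      then have "c (Suc j) \<le> c k" by (intro monoD[OF assms(1)]) simp
      then show ?thesis using \<xi>(1) unfolding u_def by linarith
    next
      case False
      then have "c (Suc k) \<le> c (Suc j)" by (intro monoD[OF assms(1)]) simp
      then show ?thesis using \<xi>(2) unfolding v_def by linarith
    qed
  qed (use R in auto)
  then have "(R / 3) * (real (Suc m) * (R / 3) ^ m) \<le> \<psi> v - \<psi> u"
    unfolding \<xi>(3) uv(4) using R by (intro mult_left_mono) auto
  also have "\<dots> \<le> \<psi> (c (Suc k)) - \<psi> (c k)"
    using mono[of "c k" u] mono[of v "c (Suc k)"] uv by auto
  finally show ?thesis
    by (simp add: \<psi>_def right_diff_distrib mult_ac)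
qed (simp add: R_def)

text \<open>
  The unknowns are the gaps \<open>g 0, \<dots>, g m\<close> between \<open>0\<close>, the real critical points and a right
  endpoint \<open>b\<close>, together with numbers \<open>t 1, \<dots>, t m \<ge> 0\<close>. The equations force \<open>b\<close> to be fixed,
  \<open>0\<close> to be sent to \<open>0\<close> or \<open>b\<close>, and the \<open>i\<close>-th critical value to lie at distance \<open>t i\<close> outside \<open>{0..b}\<close>,
  at escape rate \<open>Suc m * h i\<close>. Each equation is sign-definite on the two faces of the cube belonging
  to one of the unknowns.
\<close>

lemma exists_crit_poly_heights:
  fixes h :: "nat \<Rightarrow> real"
  assumes m: "m \<ge> 1" and h: "\<And>i. i \<in> {1..m} \<Longrightarrow> h i \<ge> 0"
  shows "\<exists>x. \<forall>i<m. escape_rate (crit_poly m x) (x i) = h (Suc i)"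
proof -
  define d where "d = Suc m"
  have d: "real d \<ge> 2" using m by (simp add: d_def)
  define H where "H = (\<Sum>i=1..m. h i)"
  have hH: "h i \<le> H" if "i \<in> {1..m}" for i
    unfolding H_def using that h by (intro member_le_sum) auto
  \<comment> \<open>The choice of \<open>K\<close> gives
    \<open>T = 4 * \<rho> * exp (d * H)\<close>: points of modulus at least \<open>T\<close> then
    escape at a rate exceeding that of any point of \<open>cball 0 \<rho>\<close> by at least
    \<open>d * H\<close>.\<close>
  define K where "K = 12 * (real d)\<^sup>2 * exp (real d * H)"
  have K0: "K \<ge> 0" by (simp add: K_def)
  \<comment> \<open>A gap of the maximal width \<open>R\<close> must produce a jump of at least
    \<open>d * R + 2 * T\<close>, which bounds \<open>b\<close> plus two of the \<open>t i\<close>.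
    This is possible because \<open>T\<close> is linear in \<open>R\<close> while the jump grows
    like \<open>R ^ d\<close>.\<close>
  define R where "R = 1 + (real d + 2 * K) * 3 ^ d"
  define T where "T = K * R"
  define r where "r = real d * R"
  define \<rho> where "\<rho> = 3 * real d * r"
  have R1: "R \<ge> 1" using K0 by (simp add: R_def)
  have r1: "r \<ge> 1"
    unfolding r_def using d R1 mult_mono[of 1 "real d" 1 R] by simp
  have T: "T = 4 * \<rho> * exp (real d * H)"
    by (simp add: T_def K_def \<rho>_def r_def power2_eq_square)
  have r\<rho>: "r \<le> \<rho>" "\<rho> > 0"
    unfolding \<rho>_def using d r1 mult_mono[of 1 "3 * real d" r r] by auto
  have H0: "H \<ge> 0"
    unfolding H_def using h by (intro sum_nonneg) auto
  have \<rho>T: "\<rho> \<le> T"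
  proof -
    have "\<rho> * 1 \<le> (4 * \<rho>) * exp (real d * H)"
      using r\<rho> H0 by (intro mult_mono) auto
    then show ?thesis by (simp add: T)
  qed
  have T0: "T > 0" using \<rho>T r\<rho> by simp
  have big: "real d * R + 2 * T \<le> real d * (R / 3) ^ d"
  proof -
    have "real d * R + 2 * T = (real d + 2 * K) * R"
      by (simp add: T_def algebra_simps)
    also have "\<dots> \<le> R / 3 ^ d * R"
      using R1 by (intro mult_right_mono) (auto simp: R_def field_simps)
    also have "\<dots> = R ^ 2 / 3 ^ d"
      by (simp add: power2_eq_square)
    also have "\<dots> \<le> 1 * (R ^ d / 3 ^ d)"
      using R1 d by (simp add: divide_right_mono power_increasing)
    also have "\<dots> \<le> real d * (R ^ d / 3 ^ d)"
      using R1 d by (intro mult_right_mono) auto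
    finally show ?thesis by (simp add: power_divide)
  qed
  \<comment> \<open>Coordinates \<open>0, ..., m\<close> of the cube are the gaps divided by
    \<open>R\<close>; coordinates \<open>m + 1, ..., m + m\<close> are the \<open>t i\<close>
    divided by \<open>T\<close>.\<close>
  define n where "n = d + m"
  define Q where "Q = {y :: nat \<Rightarrow> real. (\<forall>i<n. 0 \<le> y i \<and> y i \<le> 1) \<and> (\<forall>i\<ge>n. y i = 0)}"
  have y01: "0 \<le> y i" "y i \<le> 1" if "y \<in> Q" for y i
    using that by (auto simp: Q_def) (metis not_less order_refl zero_le_one)+
  define c where "c y i = (\<Sum>j<i. R * y j)" for y :: "nat \<Rightarrow> real" and i
  define b where "b y = c y d" for y
  \<comment> \<open>The default 0 at \<open>i = 0\<close> and \<open>i = d\<close> places the values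
    at both ends of the interval exactly at 0 or \<open>b\<close>.\<close>
  define t where "t y i = (if i \<in> {1..m} then T * y (m + i) else 0)" for y :: "nat \<Rightarrow> real" and i
  \<comment> \<open>The constant term is the value at 0; the parity of \<open>d\<close> selects it
    so that the alternation ends with the value \<open>b\<close> at \<open>b\<close>.\<close>
  define x where "x y i = complex_of_real (if i < m then c y (Suc i) else if even d then b y else 0)"
    for y i
  define f where "f y = crit_poly m (x y)" for y
  define \<phi> where "\<phi> y s = Re (poly (f y) (of_real s))" for y s
  \<comment> \<open>\<open>v\<close> is the intended value at \<open>c y i\<close>, alternately
    above and below the interval, and \<open>v0\<close> is the endpoint on the same side.\<close>
  define v where "v y i = (if even (d - i) then b y + t y i else - t y i)" for y i
  define v0 where "v0 y i = (if even (d - i) then b y else 0)" for y i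
  \<comment> \<open>The first \<open>d\<close> equations fix the jumps between consecutive values,
    the others the escape rates. Subtracting the rate of \<open>v0\<close> makes the latter
    nonpositive on the face where \<open>t\<close> vanishes, wherever the endpoints are sent; at a
    solution the subtracted term is 0.\<close>
  define F where "F k y = (if k \<le> m
      then (-1) ^ (m - k) * (\<phi> y (c y (Suc k)) - \<phi> y (c y k)) - b y - t y k - t y (Suc k)
      else escape_rate (f y) (of_real (v y (k - m))) - escape_rate (f y) (of_real (v0 y (k - m)))
        - real d * h (k - m))" for k y
  have cmono: "mono (c y)" if "y \<in> Q" for y
    unfolding mono_iff_le_Suc c_def using y01[OF that] R1 by simp
  have c0: "c y i \<ge> 0" if "y \<in> Q" for y i
    unfolding c_def using y01[OF that] R1 by (intro sum_nonneg) auto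
  have br: "b y \<le> r" if "y \<in> Q" for y
  proof -
    have "(\<Sum>j<d. R * y j) \<le> (\<Sum>j<d. R)"
      using y01[OF that] R1 by (intro sum_mono) (simp add: mult_left_le)
    then show ?thesis by (simp add: b_def c_def r_def)
  qed
  have b0: "b y \<ge> 0" if "y \<in> Q" for y
    unfolding b_def by (rule c0[OF that])
  have t0: "0 \<le> t y i" "t y i \<le> T" if "y \<in> Q" for y i
    unfolding t_def using y01[OF that] T0 by (auto simp: mult_left_le)
  have cr: "c y i \<le> r" if "y \<in> Q" "i \<le> d" for y i
    using monoD[OF cmono[OF that(1)] that(2)] br[OF that(1)] by (simp add: b_def)
  have xr: "cmod (x y j) \<le> r" if "y \<in> Q" for y j
    using cr[OF that, of "Suc j"] c0[OF that, of "Suc j"] br[OF that] b0[OF that] r1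
    by (auto simp: x_def d_def)
  have xr': "cmod (x y m) \<le> r ^ Suc m" if "y \<in> Q" for y
  proof -
    have "r ^ 1 \<le> r ^ Suc m" using r1 by (intro power_increasing) auto
    then show ?thesis using xr[OF that, of m] by simp
  qed
  have esc: "escape_radius (f y) \<rho>" if "y \<in> Q" for y
    unfolding f_def \<rho>_def d_def using m r1 xr[OF that] xr'[OF that]
    by (intro escape_radius_crit_poly) auto
  have deg: "degree (f y) = d" for y
    by (simp add: f_def degree_crit_poly d_def)
  have cont_y: "continuous_on Q (\<lambda>y. y i)" for i
    by (rule continuous_on_subset[OF continuous_on_product_coordinates]) simp
  have cont_c: "continuous_on Q (\<lambda>y. c y i)" for i
    unfolding c_def by (intro continuous_intros cont_y)
  have cont_b: "continuous_on Q b"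
    unfolding b_def[abs_def] by (rule cont_c)
  have cont_t: "continuous_on Q (\<lambda>y. t y i)" for i
    unfolding t_def by (cases "i \<in> {1..m}") (auto intro!: continuous_intros cont_y)
  have cont_x: "continuous_on Q (\<lambda>y. x y i)" for i
    unfolding x_def
    by (cases "i < m"; cases "even d") (auto intro!: continuous_intros cont_c cont_b)
  have cont_\<phi>: "continuous_on Q (\<lambda>y. \<phi> y (c y i))" for i
    unfolding \<phi>_def f_def by (intro continuous_intros continuous_on_poly_crit_poly cont_x cont_c)
  have cont_v: "continuous_on Q (\<lambda>y. v y i)" "continuous_on Q (\<lambda>y. v0 y i)" for i
    unfolding v_def v0_def
    by (cases "even (d - i)"; auto intro!: continuous_intros cont_b cont_t)+
  have cont_G: "continuous_on Q (\<lambda>y. escape_rate (f y) (of_real (z y)))"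
    if "continuous_on Q z" for z
    unfolding f_def using m r1 xr xr'
    by (intro continuous_on_escape_rate_bounded[where r = r] cont_x continuous_intros that) auto
  have "\<exists>y\<in>Q. \<forall>k<n. F k y = 0"
    unfolding Q_def
  proof (rule poincare_miranda, unfold Q_def[symmetric])
    fix k assume "k < n"
    show "continuous_on Q (F k)"
      unfolding F_def[abs_def]
      by (cases "k \<le> m") (auto intro!: continuous_intros cont_\<phi> cont_b cont_t cont_G cont_v)
  next
    fix k y assume k: "k < n" and y: "y \<in> Q" and yk: "y k = 0"
    show "F k y \<le> 0"
    proof (cases "k \<le> m")
      case True
      have "c y (Suc k) = c y k" using yk by (simp add: c_def)
      then show ?thesis
        using True b0[OF y] t0[OF y, of k] t0[OF y, of "Suc k"] by (simp add: F_def)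
    next
      case False
      then have i: "k - m \<in> {1..m}" using k by (auto simp: n_def d_def)
      then have "t y (k - m) = 0" using False yk by (simp add: t_def)
      then have "v y (k - m) = v0 y (k - m)"
        by (simp only: v_def v0_def add_0_right minus_zero)
      then show ?thesis using False h[OF i] by (simp add: F_def)
    qed
  next
    fix k y assume k: "k < n" and y: "y \<in> Q" and yk: "y k = 1"
    show "F k y \<ge> 0"
    proof (cases "k \<le> m")
      case True
      have "c y (Suc k) - c y k = R" using yk by (simp add: c_def)
      then have "real d * (R / 3) ^ d \<le> (-1) ^ (m - k) * (\<phi> y (c y (Suc k)) - \<phi> y (c y k))"
        using crit_poly_gap[OF cmono[OF y] True, of "x y"]
        by (simp add: x_def \<phi>_def f_def d_def del: of_nat_Suc power_Suc)
      then show ?thesis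
        using True big br[OF y] t0[OF y, of k] t0[OF y, of "Suc k"] by (simp add: F_def r_def)
    next
      case False
      then have i: "k - m \<in> {1..m}" using k by (auto simp: n_def d_def)
      then have "t y (k - m) = T" using False yk by (simp add: t_def)
      then have vT: "T \<le> \<bar>v y (k - m)\<bar>"
        using b0[OF y] T0 by (simp add: v_def)
      have "ln T - ln 2 \<le> ln \<bar>v y (k - m)\<bar> - ln 2"
        using vT T0 by simp
      also have "\<dots> \<le> escape_rate (f y) (of_real (v y (k - m)))"
        using escape_radius.escape_rate_ge[OF esc[OF y], of "of_real (v y (k - m))"] vT \<rho>T by simp
      finally have 1: "ln T - ln 2 \<le> escape_rate (f y) (of_real (v y (k - m)))" .
      have "\<bar>v0 y (k - m)\<bar> \<le> \<rho>"
        using b0[OF y] br[OF y] r\<rho> by (simp add: v0_def)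
      then have 2: "escape_rate (f y) (of_real (v0 y (k - m))) \<le> ln \<rho> + ln 2"
        using escape_radius.escape_rate_le[OF esc[OF y], of "of_real (v0 y (k - m))"]
        by (simp add: max_absorb1)
      have "ln T = ln (4 * \<rho>) + real d * H"
        unfolding T using r\<rho> by (subst ln_mult_pos) auto
      also have "ln (4 * \<rho>) = ln (2 ^ 2) + ln \<rho>"
        using r\<rho> by (subst ln_mult_pos) auto
      also have "ln (2 ^ 2 :: real) = 2 * ln 2"
        by (subst ln_realpow) auto
      finally have "ln T - ln 2 - (ln \<rho> + ln 2) = real d * H" by simp
      moreover have "real d * h (k - m) \<le> real d * H"
        using hH[OF i] by (intro mult_left_mono) auto
      ultimately show ?thesis using False 1 2 by (simp add: F_def)
    qed
  qed
  then obtain y where y: "y \<in> Q" and sol: "\<And>k. k < n \<Longrightarrow> F k y = 0" by blast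
  interpret escape_radius "f y" \<rho> by (rule esc[OF y])
  have real_val: "poly (f y) (of_real s) = of_real (\<phi> y s)" for s
    unfolding \<phi>_def f_def by (subst of_real_Re) (auto simp: x_def intro!: poly_crit_poly_Reals)
  \<comment> \<open>Starting from the constant term at \<open>c y 0 = 0\<close>, the prescribed
    jumps determine the values from left to right.\<close>
  have val: "\<phi> y (c y i) = v y i" if "i \<le> d" for i
    using that
  proof (induction i)
    case 0
    have "poly (f y) 0 = x y m"
      by (simp add: f_def poly_crit_poly_0)
    then show ?case by (simp add: c_def \<phi>_def v_def x_def t_def)
  next
    case (Suc i)
    then have i: "i \<le> m" by (simp add: d_def)
    define e where "e = (-1 :: real) ^ (m - i)"
    have ee: "e * e = 1"
      by (simp add: e_def flip: power_mult_distrib)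
    have "F i y = 0" using i by (intro sol) (simp add: n_def d_def)
    then have "e * (\<phi> y (c y (Suc i)) - \<phi> y (c y i)) = b y + t y i + t y (Suc i)"
      using i by (simp add: F_def e_def)
    then have "e * e * (\<phi> y (c y (Suc i)) - \<phi> y (c y i)) = e * (b y + t y i + t y (Suc i))"
      by (simp only: mult.assoc)
    then have step: "\<phi> y (c y (Suc i)) = v y i + e * (b y + t y i + t y (Suc i))"
      using Suc ee by simp
    have "d - i = Suc (m - i)" "d - Suc i = m - i" using i by (simp_all add: d_def)
    then show ?case
      unfolding step by (cases "even (m - i)") (simp_all add: v_def e_def)
  qed
  \<comment> \<open>The cases \<open>i = d\<close> and \<open>i = 0\<close> say that
    \<open>b\<close> is fixed and that 0 is fixed or sent to \<open>b\<close>, so both endpoints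
    have escape rate 0.\<close>
  have "poly (f y) (of_real (b y)) = of_real (b y)"
    unfolding real_val using val[of d] by (simp add: b_def v_def t_def d_def)
  then have Gb: "escape_rate (f y) (of_real (b y)) = 0"
    by (rule escape_rate_fixed)
  have "poly (f y) 0 = 0 \<or> poly (f y) 0 = of_real (b y)"
    using real_val[of 0] val[of 0] by (simp add: c_def v_def t_def)
  then have G0: "escape_rate (f y) 0 = 0"
    using escape_rate_fixed[of 0] escape_rate_step[of 0] Gb d by (auto simp: deg)
  have "escape_rate (f y) (x y i) = h (Suc i)" if "i < m" for i
  proof -
    have "F (m + Suc i) y = 0" using that by (intro sol) (simp add: n_def d_def)
    then have "escape_rate (f y) (of_real (v y (Suc i))) = real d * h (Suc i)"
      using Gb G0 by (auto simp: F_def v0_def split: if_splits)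
    moreover have "of_real (v y (Suc i)) = poly (f y) (x y i)"
      using that val[of "Suc i"] real_val[of "c y (Suc i)"] by (simp add: x_def d_def)
    ultimately show ?thesis
      using d by (simp add: escape_rate_step deg)
  qed
  then show ?thesis
    unfolding f_def by blast
qed

subsection \<open>Order statistics\<close>

text \<open>The positions of entries at least \<open>v\<close> form an initial segment of the
  descending list. This replaces sorting by counting.\<close>

lemma desc_sorted_nth_ge_iff:
  fixes M :: "real multiset"
  assumes "i < size M"
  shows "v \<le> rev (sorted_list_of_multiset M) ! i \<longleftrightarrow> i < size {#a \<in># M. v \<le> a#}"
proof -
  define ys where "ys = rev (sorted_list_of_multiset M)"
  have len: "length ys = size M"
    by (simp add: ys_def flip: size_mset)
  have "sorted_wrt (\<ge>) ys"
    by (simp add: ys_def sorted_wrt_rev)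
  then have desc: "ys ! k \<le> ys ! j" if "j \<le> k" "k < length ys" for j k
    using that by (cases "j = k") (auto simp: sorted_wrt_iff_nth_less)
  define J where "J = {j. j < length ys \<and> v \<le> ys ! j}"
  have "size {#a \<in># M. v \<le> a#} = size (filter_mset (\<lambda>a. v \<le> a) (mset ys))"
    by (simp add: ys_def)
  also have "\<dots> = length (filter (\<lambda>a. v \<le> a) ys)"
    by (metis mset_filter size_mset)
  also have "\<dots> = card J"
    by (simp add: J_def length_filter_conv_card)
  finally have card: "size {#a \<in># M. v \<le> a#} = card J" .
  have fin: "finite J" by (simp add: J_def)
  have "v \<le> ys ! i \<longleftrightarrow> i < card J"
  proof
    assume "v \<le> ys ! i"
    then have "{..i} \<subseteq> J"
      using desc[of _ i] assms len by (auto simp: J_def intro: order_trans)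
    from card_mono[OF fin this] show "i < card J" by simp
  next
    assume "i < card J"
    then have "\<not> J \<subseteq> {..<i}"
      using card_mono[of "{..<i}" J] by auto
    then obtain j where "j \<in> J" "i \<le> j"
      using not_less by blast
    then show "v \<le> ys ! i"
      using desc[of i j] by (auto simp: J_def)
  qed
  then show ?thesis by (simp add: card ys_def)
qed

text \<open>Lowering the threshold by \<open>e\<close> while passing from \<open>u\<close> to
  \<open>w\<close> cannot decrease the count, whatever orders sort the two families. Used in both
  directions, this is the Lipschitz bound.\<close>

lemma desc_sorted_nth_perturb:
  fixes u w :: "nat \<Rightarrow> real"
  assumes "i < m" "\<And>j. j < m \<Longrightarrow> u j \<le> w j + e"
  shows "rev (sorted_list_of_multiset (image_mset u (mset_set {..<m}))) ! i
    \<le> rev (sorted_list_of_multiset (image_mset w (mset_set {..<m}))) ! i + e"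
proof -
  define v where "v = rev (sorted_list_of_multiset (image_mset u (mset_set {..<m}))) ! i"
  have size: "size {#a \<in># image_mset u (mset_set {..<m}). v \<le> a#} = card {j. j < m \<and> v \<le> u j}" for u v
    by (simp add: filter_mset_image_mset)
  have "i < card {j. j < m \<and> v \<le> u j}"
    using desc_sorted_nth_ge_iff[of i "image_mset u (mset_set {..<m})" v] assms(1)
    by (simp add: v_def size)
  also have "\<dots> \<le> card {j. j < m \<and> v - e \<le> w j}"
    using assms(2) by (intro card_mono) force+
  finally have "v - e \<le> rev (sorted_list_of_multiset (image_mset w (mset_set {..<m}))) ! i"
    using assms(1) by (subst desc_sorted_nth_ge_iff) (simp_all add: size)
  then show ?thesis by (simp add: v_def)
qed

lemma continuous_on_desc_sorted_nth:
  fixes u :: "'a::topological_space \<Rightarrow> nat \<Rightarrow> real"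
  assumes "i < m" "\<And>j. j < m \<Longrightarrow> continuous_on S (\<lambda>s. u s j)"
  shows "continuous_on S (\<lambda>s. rev (sorted_list_of_multiset (image_mset (u s) (mset_set {..<m}))) ! i)"
    (is "continuous_on S ?F")
  unfolding continuous_on_def
proof (intro ballI tendstoI)
  fix s e assume s: "s \<in> S" and "(e::real) > 0"
  have "\<forall>\<^sub>F s' in at s within S. dist (u s' j) (u s j) < e / 2" if "j < m" for j
  proof -
    have "((\<lambda>s. u s j) \<longlongrightarrow> u s j) (at s within S)"
      using assms(2)[OF that] s by (simp add: continuous_on_def)
    then show ?thesis
      using \<open>e > 0\<close> by (intro tendstoD) auto
  qed
  then have "\<forall>\<^sub>F s' in at s within S. \<forall>j\<in>{..<m}. dist (u s' j) (u s j) < e / 2"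
    by (intro eventually_ball_finite) auto
  then show "\<forall>\<^sub>F s' in at s within S. dist (?F s') (?F s) < e"
  proof eventually_elim
    case (elim s')
    then have "\<bar>u s' j - u s j\<bar> < e / 2" if "j < m" for j
      using that by (simp add: dist_real_def)
    then have d: "u s' j \<le> u s j + e / 2" "u s j \<le> u s' j + e / 2" if "j < m" for j
      using that by (smt (verit))+
    have "?F s' \<le> ?F s + e / 2" "?F s \<le> ?F s' + e / 2"
      by (rule desc_sorted_nth_perturb[OF assms(1) d(1)], assumption,
          rule desc_sorted_nth_perturb[OF assms(1) d(2)])
    then show ?case
      using \<open>e > 0\<close> by (simp add: dist_real_def abs_le_iff abs_less_iff)
  qed
qed

subsection \<open>The topology of the parameter space\<close>

text \<open>Bounds on the first \<open>Suc m\<close> coordinates define open sets that cover the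
  whole space, and the bounded case applies on each.\<close>

lemma continuous_escape_rate_crit:
  assumes "m \<ge> 1" "j < m"
  shows "continuous_on UNIV (\<lambda>x. escape_rate (crit_poly m x) (x j))"
proof -
  define U where "U r = {x :: nat \<Rightarrow> complex. \<forall>i\<in>{..m}. x i \<in> ball 0 (real (Suc r))}" for r
  have "open (U r)" for r
    using product_topology_basis'[of "{..m}" "\<lambda>_. ball (0 :: complex) (real (Suc r))" "\<lambda>i. i"]
    unfolding U_def by simp
  moreover have "continuous_on (U r) (\<lambda>x. escape_rate (crit_poly m x) (x j))" for r
  proof (rule continuous_on_escape_rate_bounded[where r = "real (Suc r)"])
    fix x assume x: "x \<in> U r"
    then show "cmod (x i) \<le> real (Suc r)" if "i < m" for i
      using that by (auto simp: U_def intro: less_imp_le)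
    have "cmod (x m) \<le> real (Suc r) ^ 1"
      using x by (auto simp: U_def intro: less_imp_le)
    also have "\<dots> \<le> real (Suc r) ^ Suc m"
      by (intro power_increasing) auto
    finally show "cmod (x m) \<le> real (Suc r) ^ Suc m" .
  qed (use assms in \<open>auto intro: continuous_on_subset[OF continuous_on_product_coordinates]\<close>)
  ultimately have "continuous_on (\<Union>r. U r) (\<lambda>x. escape_rate (crit_poly m x) (x j))"
    by (intro continuous_on_open_UN) auto
  moreover have "(\<Union>r. U r) = UNIV"
  proof safe
    fix x :: "nat \<Rightarrow> complex"
    obtain r where "Max ((\<lambda>i. cmod (x i)) ` {..m}) < real r"
      using reals_Archimedean2 by blast
    then have "x \<in> U r"
      by (force simp: U_def)
    then show "x \<in> (\<Union>r. U r)" by blast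
  qed simp
  ultimately show ?thesis by simp
qed

lemma critical_heights_crit_poly:
  "critical_heights (crit_poly m x) = (\<lambda>i\<in>{1..m}. rev (sorted_list_of_multiset
      (image_mset (\<lambda>j. escape_rate (crit_poly m x) (x j)) (mset_set {..<m}))) ! (i - 1))"
  by (simp add: critical_heights_def degree_crit_poly proots_pderiv_crit_poly
      image_mset.compositionality o_def)

text \<open>Sum 0 expresses that the polynomial is centered; fixing the coordinates beyond
  \<open>m\<close> makes closed sets with bounded coordinates compact.\<close>

definition crit_params :: "nat \<Rightarrow> (nat \<Rightarrow> complex) set" where
  "crit_params m = {x. (\<Sum>j<m. x j) = 0 \<and> (\<forall>j>m. x j = 0)}"

lemma closed_crit_params: "closed (crit_params m)"
proof -
  have "crit_params m = {x. (\<Sum>j<m. x j) = 0} \<inter> (\<Inter>j\<in>{m<..}. {x. x j = 0})"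
    by (auto simp: crit_params_def)
  also have "closed \<dots>"
    by (intro closed_Int closed_INT ballI closed_Collect_eq continuous_intros) auto
  finally show ?thesis .
qed

text \<open>A metrizable target is a k-space, so it suffices that preimages of compact sets are
  compact; they are closed, and bounded by hypothesis.\<close>

lemma proper_map_crit_params:
  fixes f :: "(nat \<Rightarrow> complex) \<Rightarrow> 'b"
  assumes "metrizable_space Y" and cont: "continuous_map (top_of_set (crit_params m)) Y f"
    and bdd: "\<And>K. compactin Y K \<Longrightarrow>
      \<exists>B. \<forall>x\<in>crit_params m. f x \<in> K \<longrightarrow> (\<forall>j\<le>m. cmod (x j) \<le> B)"
  shows "proper_map (top_of_set (crit_params m)) Y f"
proof (rule compact_imp_proper_map)
  show "k_space Y" "kc_space Y"
    using assms(1) by (auto intro: metrizable_imp_k_space Hausdorff_imp_kc_space metrizable_imp_Hausdorff_space)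
  fix K assume K: "compactin Y K"
  let ?P = "{x \<in> topspace (top_of_set (crit_params m)). f x \<in> K}"
  have "closedin Y K"
    using K assms(1) compactin_imp_closedin metrizable_imp_Hausdorff_space by blast
  then have "closedin (top_of_set (crit_params m)) ?P"
    by (rule closedin_continuous_map_preimage[OF cont])
  then have cl: "closed ?P"
    using closed_crit_params closedin_closed_trans by blast
  obtain B where B: "\<And>x j. x \<in> crit_params m \<Longrightarrow> f x \<in> K \<Longrightarrow> j \<le> m \<Longrightarrow> cmod (x j) \<le> B"
    using bdd[OF K] by blast
  have "compact {x :: nat \<Rightarrow> complex. \<forall>j. x j \<in> (if j \<le> m then cball 0 B else {0})}"
    by (rule compact_box_fun) auto
  moreover have "?P \<subseteq> {x. \<forall>j. x j \<in> (if j \<le> m then cball 0 B else {0})}"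
    using B by (auto simp: crit_params_def)
  ultimately have "compact ?P"
    using cl by (metis (no_types, lifting) compact_Int_closed inf.absorb_iff2)
  then show "compactin (top_of_set (crit_params m)) ?P"
    by (auto simp: compactin_subtopology)
qed (use cont in \<open>auto simp: continuous_map_def\<close>)

section \<open>Critical points as parameters of monic centered polynomials\<close>

lemma subleading_coeff_crit_prod: "coeff (crit_prod (Suc m) x) m = - (\<Sum>j\<le>m. x j)"
proof (induction m)
  case 0
  then show ?case by (simp add: crit_prod_def)
next
  case (Suc m)
  have "coeff (crit_prod (Suc (Suc m)) x) (Suc m)
      = coeff (crit_prod (Suc m) x) m - x (Suc m) * coeff (crit_prod (Suc m) x) (Suc m)"
    by (simp only: crit_prod_Suc[of "Suc m"] coeff_mult_linear) simp
  then show ?case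
    by (simp add: Suc lead_coeff_crit_prod)
qed

lemma coeff_crit_poly_centered_iff:
  assumes "m \<ge> 1"
  shows "coeff (crit_poly m x) m = 0 \<longleftrightarrow> (\<Sum>j<m. x j) = 0"
proof -
  obtain k where k: "m = Suc k" using assms by (cases m) auto
  have "coeff (crit_poly m x) m = - (of_nat (Suc m) / of_nat m * (\<Sum>j<m. x j))"
    unfolding k coeff_crit_poly_Suc subleading_coeff_crit_prod lessThan_Suc_atMost by simp
  moreover have "of_nat (Suc m) / of_nat m \<noteq> (0::complex)"
    using assms by (simp del: of_nat_Suc)
  ultimately show ?thesis by (simp del: of_nat_Suc)
qed

lemma crit_poly_image:
  assumes "m \<ge> 1"
  shows "crit_poly m ` crit_params m = monic_centered (Suc m)"
proof (intro equalityI subsetI)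
  fix f assume "f \<in> crit_poly m ` crit_params m"
  then show "f \<in> monic_centered (Suc m)"
    using assms by (auto simp: crit_params_def monic_centered_def degree_crit_poly
        lead_coeff_crit_poly coeff_crit_poly_centered_iff)
next
  fix f assume f: "f \<in> monic_centered (Suc m)"
  then have deg: "degree f = Suc m" and lc: "coeff f (Suc m) = 1" and cen: "coeff f m = 0"
    by (auto simp: monic_centered_def)
  \<comment> \<open>Any enumeration of the critical points with multiplicity serves as a
    parameter.\<close>
  obtain xs where xs: "mset xs = proots (pderiv f)"
    using ex_mset by blast
  have dp: "degree (pderiv f) = m"
    by (simp add: degree_pderiv deg)
  have len: "length xs = m"
    using dp size_proots_complex by (metis size_mset xs)
  define x where "x j = (if j < m then xs ! j else 0)" for j
  have "(\<Prod>c\<in>#proots (pderiv f). [:- c, 1:]) = prod_list (map (\<lambda>c. [:- c, 1:]) xs)"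
    by (metis mset_map prod_mset_prod_list xs)
  also have "\<dots> = crit_prod m x"
    unfolding crit_prod_def prod.list_conv_set_nth
    by (rule prod.cong) (auto simp: len x_def)
  finally have "(\<Prod>c\<in>#proots (pderiv f). [:- c, 1:]) = crit_prod m x" .
  moreover have "lead_coeff (pderiv f) = of_nat (Suc m)"
    unfolding dp by (simp add: coeff_pderiv lc)
  ultimately have "pderiv f = smult (of_nat (Suc m)) (crit_prod m x)"
    by (metis complex_poly_decompose_multiset)
  then have eq: "f = crit_poly m (x(m := coeff f 0))"
    by (rule crit_poly_unique)
  have "(\<Sum>j<m. (x(m := coeff f 0)) j) = 0"
    using cen eq coeff_crit_poly_centered_iff[OF assms] by metis
  then have "x(m := coeff f 0) \<in> crit_params m"
    by (auto simp: crit_params_def x_def)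
  then show "f \<in> crit_poly m ` crit_params m"
    using eq by blast
qed

text \<open>Cauchy's bound: for \<open>cmod z > 1\<close> the lower terms add up to at most
  \<open>m * B * cmod z ^ (m - 1)\<close>. It will bound critical points by coefficients.\<close>

lemma monic_root_bound:
  fixes p :: "complex poly"
  assumes "degree p = m" "coeff p m = 1" "poly p z = 0" "\<And>k. k < m \<Longrightarrow> cmod (coeff p k) \<le> B"
  shows "cmod z \<le> max 1 (real m * B)"
proof (cases "cmod z \<le> 1")
  case False
  have m: "m \<ge> 1"
  proof (rule ccontr)
    assume "\<not> m \<ge> 1"
    then have "m = 0" by simp
    then show False
      using assms(1-3) by (simp add: poly_altdef)
  qed
  have B: "B \<ge> 0"
    using assms(4)[of 0] m norm_ge_zero order_trans by (metis less_le_trans zero_less_one)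
  have "0 = (\<Sum>k<m. coeff p k * z ^ k) + z ^ m"
    using assms(1-3) by (simp add: poly_altdef lessThan_Suc_atMost[symmetric])
  then have "z ^ m = - (\<Sum>k<m. coeff p k * z ^ k)"
    by (metis add.commute add_eq_0_iff)
  then have "cmod z ^ m = cmod (\<Sum>k<m. coeff p k * z ^ k)"
    by (metis norm_minus_cancel norm_power)
  also have "\<dots> \<le> (\<Sum>k<m. B * cmod z ^ (m - 1))"
  proof (rule sum_norm_le)
    fix k assume "k \<in> {..<m}"
    then show "cmod (coeff p k * z ^ k) \<le> B * cmod z ^ (m - 1)"
      unfolding norm_mult norm_power using False B assms(4)
      by (intro mult_mono power_increasing) auto
  qed
  also have "\<dots> = real m * B * cmod z ^ (m - 1)" by simp
  finally have "cmod z * cmod z ^ (m - 1) \<le> real m * B * cmod z ^ (m - 1)"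
    using m by (cases m) auto
  moreover have "cmod z ^ (m - 1) > 0"
    using False by (intro zero_less_power) linarith
  ultimately show ?thesis by simp
qed simp

section \<open>Bounded heights bound the parameters\<close>

text \<open>A critical point that is a root has multiplicity in \<open>f\<close> one higher than in
  \<open>pderiv f\<close>. Counting roots, \<open>m\<close> plus the number of distinct critical
  points is at most \<open>Suc m\<close>, so there is only one. Centering puts it at 0, and the
  constant term is its critical value 0.\<close>

lemma crit_poly_zero_values:
  assumes "m \<ge> 1" "x \<in> crit_params m" "\<And>j. j < m \<Longrightarrow> poly (crit_poly m x) (x j) = 0"
  shows "x j = 0"
proof -
  define f where "f = crit_poly m x"
  define D where "D = x ` {..<m}"
  have f0: "f \<noteq> 0" "pderiv f \<noteq> 0"
    using degree_crit_poly[of m x] by (auto simp: f_def pderiv_crit_poly simp del: of_nat_Suc)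
  have roots: "set_mset (proots (pderiv f)) = D"
    by (simp add: f_def proots_pderiv_crit_poly D_def)
  have "proots (pderiv f) + mset_set D \<subseteq># proots f"
  proof (rule mset_subset_eqI)
    fix c
    show "count (proots (pderiv f) + mset_set D) c \<le> count (proots f) c"
    proof (cases "c \<in> D")
      case True
      then have "poly f c = 0"
        using assms(3) by (auto simp: D_def f_def)
      then have "order c f = Suc (order c (pderiv f))"
        using f0 order_root by (intro order_pderiv) auto
      then show ?thesis
        using f0 True by (simp add: D_def)
    next
      case False
      then have "count (proots (pderiv f)) c = 0"
        using roots not_in_iff by fastforce
      then show ?thesis using False by (simp add: D_def)
    qed
  qed
  then have "m + card D \<le> Suc m"
    using size_mset_mono size_proots_complex[of f] degree_crit_poly[of m x]
    by (metis f_def card_lessThan proots_pderiv_crit_poly size_image_mset size_mset_set size_union)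
  then have "card D \<le> Suc 0" by simp
  then have eq: "x i = x 0" if "i < m" for i
  proof -
    have "x i \<in> D" "x 0 \<in> D"
      using that assms(1) by (auto simp: D_def)
    then show ?thesis
      using \<open>card D \<le> Suc 0\<close> card_le_Suc0_iff_eq[of D] D_def by blast
  qed
  have "(\<Sum>i<m. x i) = (\<Sum>i<m. x 0)"
    by (rule sum.cong[OF refl]) (rule eq, simp)
  then have x0: "x 0 = 0"
    using assms(1,2) by (simp add: crit_params_def)
  then have "x m = 0"
    using assms(3)[of 0] assms(1) by (simp add: poly_crit_poly_0)
  then show ?thesis
    using eq[of j] x0 assms(2) by (cases j m rule: linorder_cases) (auto simp: crit_params_def)
qed

text \<open>On the compact unit sphere \<open>S\<close> the sum of the moduli of the critical values
  is continuous and, by \<open>crit_poly_zero_values\<close>, positive. Its minimum gives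
  \<open>\<delta>\<close>, and homogeneity extends the bound to all sizes \<open>r\<close>.\<close>

lemma crit_values_lower_bound:
  assumes "m \<ge> 1"
  obtains \<delta> where "\<delta> > 0"
    "\<And>x r. x \<in> crit_params m \<Longrightarrow> r > 0 \<Longrightarrow> (\<And>j. j < m \<Longrightarrow> cmod (x j) \<le> r) \<Longrightarrow>
      cmod (x m) \<le> r ^ Suc m \<Longrightarrow> (\<exists>j<m. cmod (x j) = r) \<or> cmod (x m) = r ^ Suc m \<Longrightarrow>
      \<delta> * r ^ Suc m \<le> (\<Sum>j<m. cmod (poly (crit_poly m x) (x j)))"
proof -
  define S where "S = crit_params m \<inter> {x. \<forall>j. x j \<in> (if j \<le> m then cball 0 1 else {0})}
    \<inter> (\<Union>j\<in>{..m}. {x. cmod (x j) = 1})"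
  define \<Phi> where "\<Phi> x = (\<Sum>j<m. cmod (poly (crit_poly m x) (x j)))" for x
  have "compact {x :: nat \<Rightarrow> complex. \<forall>j. x j \<in> (if j \<le> m then cball 0 1 else {0})}"
    by (rule compact_box_fun) auto
  moreover have "closed (\<Union>j\<in>{..m}. {x :: nat \<Rightarrow> complex. cmod (x j) = 1})"
    by (intro closed_UN ballI closed_Collect_eq continuous_intros) auto
  ultimately have S: "compact S"
    unfolding S_def by (rule compact_Int_closed[OF closed_Int_compact[OF closed_crit_params]])
  have cont: "continuous_on S \<Phi>"
    unfolding \<Phi>_def
    by (intro continuous_intros continuous_on_poly_crit_poly
        continuous_on_subset[OF continuous_on_product_coordinates]) auto
  have pos: "\<Phi> x > 0" if "x \<in> S" for x
  proof -
    have "\<Phi> x \<noteq> 0"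
    proof
      assume "\<Phi> x = 0"
      then have "poly (crit_poly m x) (x j) = 0" if "j < m" for j
        using that by (simp add: \<Phi>_def sum_nonneg_eq_0_iff)
      then have "x j = 0" for j
        using that by - (rule crit_poly_zero_values[OF assms, of x], simp_all add: S_def)
      then show False using that by (auto simp: S_def)
    qed
    moreover have "\<Phi> x \<ge> 0" unfolding \<Phi>_def by (intro sum_nonneg) auto
    ultimately show ?thesis by simp
  qed
  obtain \<delta> where \<delta>: "\<delta> > 0" "\<And>x. x \<in> S \<Longrightarrow> \<delta> \<le> \<Phi> x"
  proof (cases "S = {}")
    case False
    then obtain x0 where "x0 \<in> S" "\<And>x. x \<in> S \<Longrightarrow> \<Phi> x0 \<le> \<Phi> x"
      using continuous_attains_inf[OF S _ cont] by blast
    then show ?thesis using pos that by blast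
  qed (use that[of 1] in auto)
  show thesis
  proof (rule that[OF \<delta>(1)])
    fix x :: "nat \<Rightarrow> complex" and r :: real
    assume x: "x \<in> crit_params m" and r: "r > 0" and le: "\<And>j. j < m \<Longrightarrow> cmod (x j) \<le> r"
      and le': "cmod (x m) \<le> r ^ Suc m"
      and eq: "(\<exists>j<m. cmod (x j) = r) \<or> cmod (x m) = r ^ Suc m"
    \<comment> \<open>\<open>y\<close> is \<open>x\<close> rescaled to size 1 with the weights of
      \<open>crit_poly_scale\<close>.\<close>
    define y where "y i = (if i < m then x i / of_real r else x i / of_real (r ^ Suc m))" for i
    have xy: "x = (\<lambda>i. if i < m then of_real r * y i else of_real r ^ Suc m * y i)"
      using r by (auto simp: y_def fun_eq_iff)
    have rm: "r ^ Suc m > 0" using r by (rule zero_less_power)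
    have "(\<Sum>j<m. y j) = (\<Sum>j<m. x j) / of_real r"
      by (simp add: y_def sum_divide_distrib)
    then have "y \<in> crit_params m"
      using x by (auto simp: crit_params_def y_def)
    moreover have "cmod (y j) \<le> 1" if "j \<le> m" for j
      using that le[of j] le' r rm
      by (cases "j = m") (auto simp: y_def norm_divide norm_power norm_mult)
    moreover have "y j = 0" if "j > m" for j
      using that x by (simp add: crit_params_def y_def)
    moreover have "\<exists>j\<le>m. cmod (y j) = 1"
    proof (cases "\<exists>j<m. cmod (x j) = r")
      case True
      then obtain j where "j < m" "cmod (x j) = r" by blast
      then show ?thesis using r by (intro exI[of _ j]) (auto simp: y_def norm_divide)
    next
      case False
      then show ?thesis using eq r rm
        by (intro exI[of _ m]) (auto simp: y_def norm_divide norm_power norm_mult)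
    qed
    ultimately have "y \<in> S"
      by (auto simp: S_def)
    from \<delta>(2)[OF this] have "\<delta> * r ^ Suc m \<le> \<Phi> y * r ^ Suc m"
      using rm by (intro mult_right_mono) auto
    also have "\<dots> = (\<Sum>j<m. cmod (poly (crit_poly m x) (x j)))"
      unfolding \<Phi>_def sum_distrib_right
    proof (rule sum.cong)
      fix j assume "j \<in> {..<m}"
      then have "x j = of_real r * y j" using r by (simp add: y_def)
      then have "poly (crit_poly m x) (x j) = of_real r ^ Suc m * poly (crit_poly m y) (y j)"
        using crit_poly_scale[of m "of_real r" y "y j"] xy by metis
      then show "cmod (poly (crit_poly m y) (y j)) * r ^ Suc m = cmod (poly (crit_poly m x) (x j))"
        using r by (simp add: norm_mult norm_power)
    qed simp
    finally show "\<delta> * r ^ Suc m \<le> (\<Sum>j<m. cmod (poly (crit_poly m x) (x j)))" .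
  qed
qed

text \<open>Bounded escape rates keep the critical values below a multiple of the weighted size
  \<open>r\<close>, while their moduli add up to at least
  \<open>\<delta> * r ^ Suc m\<close>.\<close>

lemma crit_params_bounded_if_heights_bounded:
  assumes "m \<ge> 1"
  obtains B where "\<And>x j. x \<in> crit_params m \<Longrightarrow> j \<le> m \<Longrightarrow>
    (\<And>i. i < m \<Longrightarrow> escape_rate (crit_poly m x) (x i) \<le> M) \<Longrightarrow> cmod (x j) \<le> B"
proof -
  obtain \<delta> where \<delta>: "\<delta> > 0"
    "\<And>x r. x \<in> crit_params m \<Longrightarrow> r > 0 \<Longrightarrow> (\<And>j. j < m \<Longrightarrow> cmod (x j) \<le> r) \<Longrightarrow>
      cmod (x m) \<le> r ^ Suc m \<Longrightarrow> (\<exists>j<m. cmod (x j) = r) \<or> cmod (x m) = r ^ Suc m \<Longrightarrow>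
      \<delta> * r ^ Suc m \<le> (\<Sum>j<m. cmod (poly (crit_poly m x) (x j)))"
    using crit_values_lower_bound[OF assms] by blast
  \<comment> \<open>The first summand covers critical values inside the escape radius, the second
    those outside, whose modulus is at most \<open>2 * exp (Suc m * M)\<close>.\<close>
  define K where "K = 3 * real (Suc m) + 2 * exp (real (Suc m) * M)"
  define B where "B = max 1 (real m * K / \<delta>)"
  have B1: "B \<ge> 1" by (simp add: B_def)
  have B': "B \<le> B ^ Suc m"
    using power_increasing[of 1 "Suc m" B] B1 by simp
  have "cmod (x j) \<le> B ^ Suc m"
    if x: "x \<in> crit_params m" and j: "j \<le> m"
      and M: "\<And>i. i < m \<Longrightarrow> escape_rate (crit_poly m x) (x i) \<le> M" for x j
  proof -
    \<comment> \<open>The root accounts for the weight \<open>Suc m\<close> of the constant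
      term.\<close>
    define s where "s = root (Suc m) (cmod (x m))"
    define r where "r = Max (insert s ((\<lambda>j. cmod (x j)) ` {..<m}))"
    have s: "s ^ Suc m = cmod (x m)" "s \<ge> 0"
      by (auto simp: s_def simp del: power_Suc)
    have rs: "s \<le> r" "\<And>j. j < m \<Longrightarrow> cmod (x j) \<le> r"
      unfolding r_def by (rule Max_ge; auto)+
    have "r \<in> insert s ((\<lambda>j. cmod (x j)) ` {..<m})"
      unfolding r_def by (rule Max_in) auto
    then have eq: "(\<exists>j<m. cmod (x j) = r) \<or> cmod (x m) = r ^ Suc m"
      using s(1) by auto
    have xm: "cmod (x m) \<le> r ^ Suc m"
      unfolding s(1)[symmetric] using s(2) rs(1) by (intro power_mono) auto
    have "r \<le> B"
    proof (cases "r \<le> 1")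
      case False
      then have r: "r > 1" by simp
      interpret escape_radius "crit_poly m x" "3 * real (Suc m) * r"
        using assms rs xm r by (intro escape_radius_crit_poly) auto
      have val: "cmod (poly (crit_poly m x) (x i)) \<le> K * r" if "i < m" for i
      proof (cases "3 * real (Suc m) * r \<le> cmod (poly (crit_poly m x) (x i))")
        case True
        then have pos: "cmod (poly (crit_poly m x) (x i)) > 0"
          using radius_ge_2 by linarith
        have "ln (cmod (poly (crit_poly m x) (x i))) \<le> real (Suc m) * M + ln 2"
          using escape_rate_ge[OF True] escape_rate_step[of "x i"] M[OF that]
            mult_left_mono[OF M[OF that], of "real (Suc m)"]
          unfolding degree_crit_poly by linarith
        then have "cmod (poly (crit_poly m x) (x i)) \<le> exp (real (Suc m) * M + ln 2)"
          using pos by (metis exp_le_cancel_iff exp_ln)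
        also have "\<dots> = 2 * exp (real (Suc m) * M) * 1"
          by (simp add: exp_add)
        also have "\<dots> \<le> K * r"
          using r by (intro mult_mono) (auto simp: K_def)
        finally show ?thesis .
      next
        case False
        then have "cmod (poly (crit_poly m x) (x i)) \<le> 3 * real (Suc m) * r" by simp
        also have "\<dots> \<le> K * r"
          using r by (intro mult_right_mono) (auto simp: K_def)
        finally show ?thesis .
      qed
      \<comment> \<open>Since \<open>r > 1\<close> and \<open>Suc m \<ge> 2\<close>, two factors
        \<open>r\<close> may be kept; one of them cancels against the linear upper bound.\<close>
      have "\<delta> * r * r \<le> \<delta> * r ^ Suc m"
        using \<delta>(1) r assms power_increasing[of 2 "Suc m" r] by (simp add: power2_eq_square)
      also have "\<dots> \<le> (\<Sum>j<m. cmod (poly (crit_poly m x) (x j)))"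
        using \<delta>(2)[OF x _ rs(2) xm eq] r by simp
      also have "\<dots> \<le> (\<Sum>j<m. K * r)"
        using val by (intro sum_mono) auto
      finally have "(\<delta> * r) * r \<le> (real m * K) * r" by (simp add: mult.assoc)
      then have "\<delta> * r \<le> real m * K" using r by simp
      then show ?thesis
        using \<delta>(1) by (simp add: B_def field_simps le_max_iff_disj)
    qed (use B1 in simp)
    then have "r ^ Suc m \<le> B ^ Suc m"
      using s(2) rs(1) by (intro power_mono) auto
    then show ?thesis
      using j rs(2)[of j] xm \<open>r \<le> B\<close> B' by (cases "j = m") auto
  qed
  then show thesis using that by blast
qed

section \<open>Heights and polynomials as maps on the parameter space\<close>

lemma metrizable_heights_space: "metrizable_space (heights_space d)"
  unfolding heights_space_def
  by (intro metrizable_space_subtopology)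
    (auto simp: metrizable_space_product_topology metrizable_space_euclidean)

lemma continuous_map_crit_heights:
  assumes "m \<ge> 1"
  shows "continuous_map (top_of_set (crit_params m)) (heights_space (Suc m))
    (\<lambda>x. critical_heights (crit_poly m x))"
proof -
  have "continuous_on (crit_params m) (\<lambda>x. critical_heights (crit_poly m x) i)" if "i \<in> {1..m}" for i
    using that assms
    by (auto simp: critical_heights_crit_poly intro!: continuous_on_desc_sorted_nth
        continuous_on_subset[OF continuous_escape_rate_crit])
  then have "continuous_map (top_of_set (crit_params m)) (powertop_real {1..m})
      (\<lambda>x. critical_heights (crit_poly m x))"
    by (auto simp: continuous_map_componentwise critical_heights_crit_poly)
  moreover have "0 \<le> critical_heights (crit_poly m x) i"
    and "i \<le> j \<Longrightarrow> critical_heights (crit_poly m x) j \<le> critical_heights (crit_poly m x) i"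
    if "i \<in> {1..m}" "j \<in> {1..m}" for x i j
  proof -
    define ys where "ys = rev (sorted_list_of_multiset
      (image_mset (\<lambda>j. escape_rate (crit_poly m x) (x j)) (mset_set {..<m})))"
    have ch: "critical_heights (crit_poly m x) i = ys ! (i - 1)" if "i \<in> {1..m}" for i
      using that by (simp add: critical_heights_crit_poly ys_def)
    have len: "length ys = m"
      by (simp add: ys_def flip: size_mset)
    have set: "set ys = (\<lambda>j. escape_rate (crit_poly m x) (x j)) ` {..<m}"
      by (simp add: ys_def)
    \<comment> \<open>Any single parameter has some bound \<open>r\<close>, hence an escape radius,
      which gives nonnegative rates.\<close>
    define r where "r = Max (insert 1 ((\<lambda>j. cmod (x j)) ` {..m}))"
    have r: "r \<ge> 1" "\<And>j. j \<le> m \<Longrightarrow> cmod (x j) \<le> r"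
      unfolding r_def by (rule Max_ge; auto)+
    have "r ^ 1 \<le> r ^ Suc m"
      using r by (intro power_increasing) auto
    then interpret escape_radius "crit_poly m x" "3 * real (Suc m) * r"
      using assms r r(2)[of m] by (intro escape_radius_crit_poly) (auto simp del: power_Suc intro: order_trans)
    have "ys ! (i - 1) \<in> set ys"
      using that len by (intro nth_mem) auto
    then show "0 \<le> critical_heights (crit_poly m x) i"
      using that escape_rate_nonneg by (auto simp: ch set)
    have "sorted_wrt (\<ge>) ys"
      by (simp add: ys_def sorted_wrt_rev)
    then show "critical_heights (crit_poly m x) j \<le> critical_heights (crit_poly m x) i" if "i \<le> j"
      using that \<open>i \<in> {1..m}\<close> \<open>j \<in> {1..m}\<close> len
      by (cases "i = j") (auto simp: ch sorted_wrt_iff_nth_less)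
  qed
  ultimately show ?thesis
    unfolding heights_space_def
    by (intro continuous_map_into_subtopology) auto
qed

text \<open>A compact set bounds the first height, which is the largest, and so the escape rates of
  all critical points; these bound the parameter.\<close>

lemma proper_map_crit_heights:
  assumes "m \<ge> 1"
  shows "proper_map (top_of_set (crit_params m)) (heights_space (Suc m))
    (\<lambda>x. critical_heights (crit_poly m x))"
proof (rule proper_map_crit_params[OF metrizable_heights_space continuous_map_crit_heights[OF assms]])
  fix K assume K: "compactin (heights_space (Suc m)) K"
  then have "compactin (powertop_real {1..m}) K"
    by (simp add: heights_space_def compactin_subtopology)
  then have "compactin euclideanreal ((\<lambda>h. h 1) ` K)"
    using assms continuous_map_product_projection[of 1 "{1..m}" "\<lambda>_. euclideanreal"]
    by (intro image_compactin) auto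
  then obtain M where M: "\<And>h. h \<in> K \<Longrightarrow> h 1 \<le> M"
    using compact_imp_bounded bounded_real
    by (metis (mono_tags, lifting) abs_le_D1 compactin_euclidean_iff imageI)
  obtain B where B: "\<And>x j. x \<in> crit_params m \<Longrightarrow> j \<le> m \<Longrightarrow>
      (\<And>i. i < m \<Longrightarrow> escape_rate (crit_poly m x) (x i) \<le> M) \<Longrightarrow> cmod (x j) \<le> B"
    using crit_params_bounded_if_heights_bounded[OF assms, of M thesis] by blast
  have "escape_rate (crit_poly m x) (x i) \<le> M" if "critical_heights (crit_poly m x) \<in> K" "i < m" for x i
  proof -
    let ?u = "\<lambda>j. escape_rate (crit_poly m x) (x j)"
    have "0 < card {j. j < m \<and> ?u i \<le> ?u j}"
      using that by (auto simp: card_gt_0_iff)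
    then have "?u i \<le> rev (sorted_list_of_multiset (image_mset ?u (mset_set {..<m}))) ! 0"
      using assms by (subst desc_sorted_nth_ge_iff) (simp_all add: filter_mset_image_mset)
    also have "\<dots> = critical_heights (crit_poly m x) 1"
      using assms by (simp add: critical_heights_crit_poly)
    also have "\<dots> \<le> M" using M that by blast
    finally show ?thesis .
  qed
  then show "\<exists>B. \<forall>x\<in>crit_params m. critical_heights (crit_poly m x) \<in> K \<longrightarrow> (\<forall>j\<le>m. cmod (x j) \<le> B)"
    using B by blast
qed

text \<open>A closed continuous surjection is a quotient map. Closedness comes from properness of
  the coefficient map: bounded coefficients bound the constant term directly, and the critical
  points by Cauchy's bound for the derivative.\<close>

lemma quotient_map_crit_poly:
  assumes "m \<ge> 1"
  shows "quotient_map (top_of_set (crit_params m)) (monic_centered_topology (Suc m)) (crit_poly m)"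
proof (rule continuous_closed_imp_quotient_map)
  let ?P = "product_topology (\<lambda>_. euclidean :: complex topology) {..<m}"
  define \<kappa> where "\<kappa> f = (\<lambda>i\<in>{..<m}. coeff f i)" for f :: "complex poly"
  have top: "monic_centered_topology (Suc m) = pullback_topology (monic_centered (Suc m)) \<kappa> ?P"
    by (simp add: monic_centered_topology_def \<kappa>_def[abs_def])
  have "continuous_on (crit_params m) (\<lambda>x. coeff (crit_poly m x) i)" for i
    by (intro continuous_on_coeff_crit_poly continuous_on_subset[OF continuous_on_product_coordinates]) auto
  then have cont: "continuous_map (top_of_set (crit_params m)) ?P (\<kappa> \<circ> crit_poly m)"
    by (auto simp: continuous_map_componentwise \<kappa>_def)
  have "proper_map (top_of_set (crit_params m)) ?P (\<kappa> \<circ> crit_poly m)"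
  proof (rule proper_map_crit_params[OF _ cont])
    show "metrizable_space ?P"
      by (auto simp: metrizable_space_product_topology metrizable_space_euclidean)
    fix K assume K: "compactin ?P K"
    have "\<exists>B. \<forall>v\<in>K. cmod (v i) \<le> B" if "i < m" for i
    proof -
      have "compactin euclidean ((\<lambda>v. v i) ` K)"
        using that by (intro image_compactin[OF K] continuous_map_product_projection) auto
      then have "bounded ((\<lambda>v. v i) ` K)"
        by (simp add: compact_imp_bounded)
      then show ?thesis by (auto simp: bounded_iff)
    qed
    then obtain b where b: "\<And>v i. v \<in> K \<Longrightarrow> i < m \<Longrightarrow> cmod (v i) \<le> b i" by metis
    define B where "B = Max (insert 0 (b ` {..<m}))"
    have B: "B \<ge> 0" "\<And>i. i < m \<Longrightarrow> b i \<le> B" by (auto simp: B_def)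
    have "cmod (x j) \<le> max B (max 1 (real m * B))"
      if x: "x \<in> crit_params m" and xK: "(\<kappa> \<circ> crit_poly m) x \<in> K" and j: "j \<le> m" for x j
    proof -
      have c: "cmod (coeff (crit_poly m x) i) \<le> B" if "i \<le> m" for i
      proof (cases "i = m")
        case True
        then show ?thesis
          using x B(1) coeff_crit_poly_centered_iff[OF assms, of x] by (simp add: crit_params_def)
      next
        case False
        then show ?thesis
          using b[OF xK, of i] B(2)[of i] that by (simp add: \<kappa>_def)
      qed
      show ?thesis
      proof (cases "j = m")
        case True
        then show ?thesis using c[of 0] by (simp add: coeff_crit_poly_0)
      next
        case False
        have "cmod (coeff (crit_prod m x) k) \<le> B" if "k < m" for k
        proof -
          have "coeff (crit_prod m x) k = of_nat (Suc k) / of_nat (Suc m) * coeff (crit_poly m x) (Suc k)"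
            by (simp add: coeff_crit_poly_Suc del: of_nat_Suc)
          then have "cmod (coeff (crit_prod m x) k)
              = real (Suc k) / real (Suc m) * cmod (coeff (crit_poly m x) (Suc k))"
            by (simp add: norm_mult norm_divide del: of_nat_Suc)
          also have "\<dots> \<le> 1 * B"
            using that by (intro mult_mono c) auto
          finally show ?thesis by simp
        qed
        moreover have "poly (crit_prod m x) (x j) = 0"
          using False j by (auto simp: poly_crit_prod)
        ultimately have "cmod (x j) \<le> max 1 (real m * B)"
          by (intro monic_root_bound[OF degree_crit_prod lead_coeff_crit_prod])
        then show ?thesis by simp
      qed
    qed
    then show "\<exists>B. \<forall>x\<in>crit_params m. (\<kappa> \<circ> crit_poly m) x \<in> K \<longrightarrow> (\<forall>j\<le>m. cmod (x j) \<le> B)"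
      by blast
  qed
  then have closed: "closed_map (top_of_set (crit_params m)) ?P (\<kappa> \<circ> crit_poly m)"
    by (rule proper_imp_closed_map)
  \<comment> \<open>Injectivity of \<open>\<kappa>\<close> on monic centered polynomials identifies
    the image of \<open>C\<close> under \<open>crit_poly m\<close> with the
    \<open>\<kappa>\<close>-preimage of a closed set.\<close>
  have inj: "f = g" if "f \<in> monic_centered (Suc m)" "g \<in> monic_centered (Suc m)" "\<kappa> f = \<kappa> g" for f g
  proof (rule poly_eqI)
    fix i
    consider "i < m" | "i = m" | "i = Suc m" | "i > Suc m" by linarith
    then show "coeff f i = coeff g i"
    proof cases
      case 1
      then show ?thesis using fun_cong[OF that(3), of i] by (simp add: \<kappa>_def)
    qed (use that in \<open>auto simp: monic_centered_def coeff_eq_0\<close>)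
  qed
  show "continuous_map (top_of_set (crit_params m)) (monic_centered_topology (Suc m)) (crit_poly m)"
    unfolding top using crit_poly_image[OF assms] by (intro continuous_map_pullback'[OF cont]) auto
  show "crit_poly m ` topspace (top_of_set (crit_params m)) = topspace (monic_centered_topology (Suc m))"
    by (simp add: crit_poly_image[OF assms] topspace_monic_centered)
  show "closed_map (top_of_set (crit_params m)) (monic_centered_topology (Suc m)) (crit_poly m)"
    unfolding closed_map_def
  proof (intro allI impI)
    fix C assume C: "closedin (top_of_set (crit_params m)) C"
    then have sub: "C \<subseteq> crit_params m"
      using closedin_subset by fastforce
    have img: "crit_poly m ` C \<subseteq> monic_centered (Suc m)"
      using sub crit_poly_image[OF assms] by blast
    have "closedin ?P ((\<kappa> \<circ> crit_poly m) ` C)"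
      using closed C by (simp add: closed_map_def)
    moreover have "continuous_map (monic_centered_topology (Suc m)) ?P (id \<circ> \<kappa>)"
      unfolding top by (intro continuous_map_pullback) simp
    ultimately have "closedin (monic_centered_topology (Suc m))
        {f \<in> topspace (monic_centered_topology (Suc m)). (id \<circ> \<kappa>) f \<in> (\<kappa> \<circ> crit_poly m) ` C}"
      by (intro closedin_continuous_map_preimage)
    also have "{f \<in> topspace (monic_centered_topology (Suc m)). (id \<circ> \<kappa>) f \<in> (\<kappa> \<circ> crit_poly m) ` C}
        = crit_poly m ` C"
    proof -
      have "f \<in> crit_poly m ` C" if f: "f \<in> monic_centered (Suc m)" and "x \<in> C" "\<kappa> f = \<kappa> (crit_poly m x)" for f x
        using inj[OF f _ that(3)] img \<open>x \<in> C\<close> by blast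
      then show ?thesis
        using img by (auto simp: topspace_monic_centered)
    qed
    finally show "closedin (monic_centered_topology (Suc m)) (crit_poly m ` C)" .
  qed
qed

section \<open>Descent to the moduli space\<close>

text \<open>By surjectivity of \<open>q\<close>, the image of a closed set under \<open>g\<close> is
  the image of its \<open>q\<close>-preimage under \<open>g \<circ> q\<close>, and a fiber of
  \<open>g\<close> is the \<open>q\<close>-image of a compact fiber.\<close>

lemma proper_map_from_composition_left_quotient:
  assumes "continuous_map X Y q" "q ` topspace X = topspace Y" "proper_map X Z (g \<circ> q)"
  shows "proper_map Y Z g"
  unfolding proper_map_def closed_map_def
proof (intro conjI allI ballI impI)
  fix C assume C: "closedin Y C"
  then have "closedin X {x \<in> topspace X. q x \<in> C}"
    by (rule closedin_continuous_map_preimage[OF assms(1)])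
  then have "closedin Z ((g \<circ> q) ` {x \<in> topspace X. q x \<in> C})"
    using proper_imp_closed_map[OF assms(3)] unfolding closed_map_def by blast
  also have "(g \<circ> q) ` {x \<in> topspace X. q x \<in> C} = g ` C"
  proof -
    have "q ` {x \<in> topspace X. q x \<in> C} = C"
      using closedin_subset[OF C] unfolding assms(2)[symmetric] by auto
    then show ?thesis by (simp only: image_comp[symmetric])
  qed
  finally show "closedin Z (g ` C)" .
next
  fix z assume "z \<in> topspace Z"
  then have "compactin X {x \<in> topspace X. (g \<circ> q) x = z}"
    using assms(3) by (simp add: proper_map_def)
  then have "compactin Y (q ` {x \<in> topspace X. (g \<circ> q) x = z})"
    by (rule image_compactin[OF _ assms(1)])
  also have "q ` {x \<in> topspace X. (g \<circ> q) x = z} = {y \<in> topspace Y. g y = z}"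
    unfolding assms(2)[symmetric] by auto
  finally show "compactin Y {y \<in> topspace Y. g y = z}" .
qed

theorem theorem1p1:
  fixes d :: nat
  assumes "d \<ge> 2"
  shows "continuous_map (moduli_space d) (heights_space d) critical_heights_map
    \<and> proper_map (moduli_space d) (heights_space d) critical_heights_map
    \<and> critical_heights_map ` topspace (moduli_space d) = topspace (heights_space d)"
proof -
  obtain m where d: "d = Suc m" and m: "m \<ge> 1"
    using assms that[of "d - 1"] by simp
  let ?X = "top_of_set (crit_params m)"
  \<comment> \<open>Both factors of \<open>q\<close> are quotient maps, and composing with
    \<open>q\<close> turns the heights map into the one on parameters.\<close>
  define q where "q = conj_class \<circ> crit_poly m"
  have quot: "quotient_map ?X (moduli_space d) q"
    unfolding q_def d
    by (rule quotient_map_compose[OF quotient_map_crit_poly[OF m]])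
      (use quotient_map_conj_class[OF assms] in \<open>simp add: d\<close>)
  have comp: "critical_heights_map \<circ> q = (\<lambda>x. critical_heights (crit_poly m x))"
    using m by (auto simp: q_def fun_eq_iff critical_heights_map_conj_class degree_crit_poly)
  have cont: "continuous_map (moduli_space d) (heights_space d) critical_heights_map"
    using continuous_compose_quotient_map_eq[OF quot] continuous_map_crit_heights[OF m]
    unfolding comp[symmetric] d by blast
  moreover have "proper_map (moduli_space d) (heights_space d) critical_heights_map"
    using proper_map_from_composition_left_quotient[OF quotient_imp_continuous_map[OF quot]
        quotient_imp_surjective_map[OF quot]] proper_map_crit_heights[OF m]
    unfolding comp[symmetric] d by blast
  moreover have "critical_heights_map ` topspace (moduli_space d) = topspace (heights_space d)"
  proof
    show "critical_heights_map ` topspace (moduli_space d) \<subseteq> topspace (heights_space d)"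
      using cont by (rule continuous_map_image_subset_topspace)
    show "topspace (heights_space d) \<subseteq> critical_heights_map ` topspace (moduli_space d)"
    proof
      fix h assume "h \<in> topspace (heights_space d)"
      then have ext: "h \<in> extensional {1..m}" and nonneg: "\<And>i. i \<in> {1..m} \<Longrightarrow> 0 \<le> h i"
        and desc: "\<And>i j. i \<in> {1..m} \<Longrightarrow> j \<in> {1..m} \<Longrightarrow> i \<le> j \<Longrightarrow> h j \<le> h i"
        unfolding heights_space_def d topspace_subtopology topspace_product_topology PiE_def by auto
      obtain x where x: "\<And>i. i < m \<Longrightarrow> escape_rate (crit_poly m x) (x i) = h (Suc i)"
        using exists_crit_poly_heights[of m h] m nonneg by blast
      define f where "f = crit_poly m x"
      \<comment> \<open>The heights at \<open>x 0, ..., x (m - 1)\<close> are already in descending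
        order, so \<open>critical_heights_labelling\<close> reads them off.\<close>
      have "critical_heights f i = h i" if i: "i \<in> {1..m}" for i
      proof -
        have "critical_heights f i = escape_rate f (map x [0..<m] ! (i - 1))"
        proof (rule critical_heights_labelling)
          show "mset (map x [0..<m]) = proots (pderiv f)"
            by (simp add: f_def proots_pderiv_crit_poly mset_upt atLeast0LessThan)
          show "sorted_wrt (\<lambda>z w. escape_rate f w \<le> escape_rate f z) (map x [0..<m])"
            using x desc by (auto simp: sorted_wrt_iff_nth_less f_def)
          show "i \<in> {1..degree f - 1}"
            using i by (simp add: f_def degree_crit_poly)
        qed
        also have "\<dots> = h i"
        proof -
          have "i - 1 < m" "Suc (i - 1) = i" using i by auto
          then show ?thesis using x[of "i - 1"] by (simp add: f_def)
        qed
        finally show ?thesis .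
      qed
      moreover have "critical_heights f \<in> extensional {1..m}"
        by (simp add: critical_heights_def f_def degree_crit_poly)
      ultimately have "critical_heights f = h"
        using ext by (intro extensionalityI) auto
      then have "critical_heights_map (conj_class f) = h"
        using m by (simp add: critical_heights_map_conj_class f_def degree_crit_poly)
      moreover have "conj_class f \<in> topspace (moduli_space d)"
        by (simp add: topspace_moduli_space conj_class_in_moduli_set f_def degree_crit_poly d)
      ultimately show "h \<in> critical_heights_map ` topspace (moduli_space d)" by blast
    qed
  qed
  ultimately show ?thesis by blast
qed

end
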